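(* For every tree $T$ with $t\ge 2$ vertices there is a constant $M$ (depending only on $T$) such that the following holds. For every real $\epsilon>0$ there exists an integer $\tau_0$ such that for every integer $\tau\ge\tau_0$ with $t\mid\tau$ there is a real constant $C$ with the following property: if $p=p(n)\in(0,1]$ satisfies $p>\frac{C\log n}{n}$, then, as $n\to\infty$ along multiples of $\tau$, with probability tending to $1$ the random graph $G_{n,p}$ contains a collection of pairwise edge-disjoint $T$-factors such that the number of edges of $G_{n,p}$ not covered by these $T$-factors is at most $M\epsilon\cdot|E(G_{n,p})|$.
   Context: $G_{n,p}$ is the random graph on $n$ labelled vertices in which each of the $\binom n2$ possible edges is present independently with probability $p$. For a graph $H$ with $t$ vertices and a graph $G$ with $n$ vertices, $t\mid n$, an $H$-factor of $G$ is a collection of $n/t$ vertex-disjoint (not necessarily induced) subgraphs of $G$, each isomorphic to $H$ (so they cover all vertices of $G$). Logarithms are natural. *)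

theory Defs
  imports "HOL-Probability.Probability"
begin

datatype 'v ugraph = Ugraph (verts: "'v set") (edges: "'v set set")

definition simple_graph :: "'v ugraph \<Rightarrow> bool" where
  "simple_graph G \<longleftrightarrow> finite (verts G) \<and> (\<forall>e\<in>edges G. e \<subseteq> verts G \<and> card e = 2)"

definition adj :: "'v ugraph \<Rightarrow> 'v \<Rightarrow> 'v \<Rightarrow> bool" where
  "adj G u v \<longleftrightarrow> {u, v} \<in> edges G"

definition graph_connected :: "'v ugraph \<Rightarrow> bool" where
  "graph_connected G \<longleftrightarrow> verts G \<noteq> {} \<and> (\<forall>u\<in>verts G. \<forall>v\<in>verts G. (adj G)\<^sup>*\<^sup>* u v)"

text \<open>A cycle is given by the list of its vertices in cyclic order; its first vertex is not
  repeated at the end.\<close>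

definition is_cycle :: "'v ugraph \<Rightarrow> 'v list \<Rightarrow> bool" where
  "is_cycle G c \<longleftrightarrow> length c \<ge> 3 \<and> distinct c \<and> set c \<subseteq> verts G \<and>
     (\<forall>i<length c. adj G (c ! i) (c ! (Suc i mod length c)))"

definition is_tree :: "'v ugraph \<Rightarrow> bool" where
  "is_tree T \<longleftrightarrow> simple_graph T \<and> graph_connected T \<and> (\<nexists>c. is_cycle T c)"

definition isomorphic :: "'v ugraph \<Rightarrow> 'w ugraph \<Rightarrow> bool" where
  "isomorphic G H \<longleftrightarrow>
     (\<exists>f. bij_betw f (verts G) (verts H) \<and>
          (\<forall>u\<in>verts G. \<forall>v\<in>verts G. adj G u v \<longleftrightarrow> adj H (f u) (f v)))"

definition subgraph_of :: "'v ugraph \<Rightarrow> 'v ugraph \<Rightarrow> bool" where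
  "subgraph_of S G \<longleftrightarrow> simple_graph S \<and> verts S \<subseteq> verts G \<and> edges S \<subseteq> edges G"

text \<open>The cardinality condition says that there are \<open>n / t\<close> copies, where \<open>n\<close> and \<open>t\<close> are the
  numbers of vertices of \<open>G\<close> and \<open>H\<close>; in particular it forces \<open>t\<close> to divide \<open>n\<close>.\<close>

definition graph_factor :: "'h ugraph \<Rightarrow> 'v ugraph \<Rightarrow> 'v ugraph set \<Rightarrow> bool" where
  "graph_factor H G F \<longleftrightarrow>
     (\<forall>S\<in>F. subgraph_of S G \<and> isomorphic S H) \<and>
     pairwise (\<lambda>S S'. disjnt (verts S) (verts S')) F \<and>
     card F * card (verts H) = card (verts G)"

definition factor_edges :: "'v ugraph set \<Rightarrow> 'v set set" where
  "factor_edges F = (\<Union>S\<in>F. edges S)"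

definition edge_disjoint_factors :: "'h ugraph \<Rightarrow> 'v ugraph \<Rightarrow> 'v ugraph set set \<Rightarrow> bool" where
  "edge_disjoint_factors H G \<F> \<longleftrightarrow>
     (\<forall>F\<in>\<F>. graph_factor H G F) \<and>
     pairwise (\<lambda>F F'. disjnt (factor_edges F) (factor_edges F')) \<F>"

definition uncovered_edges :: "'v ugraph \<Rightarrow> 'v ugraph set set \<Rightarrow> 'v set set" where
  "uncovered_edges G \<F> = edges G - (\<Union>F\<in>\<F>. factor_edges F)"

definition all_pairs :: "nat \<Rightarrow> nat set set" where
  "all_pairs n = {e. e \<subseteq> {..<n} \<and> card e = 2}"

text \<open>The \<open>bernoulli_pmf\<close> parameter is clamped to the unit interval, so \<open>gnp n p\<close> is meaningful
  only for \<open>p\<close> between 0 and 1.\<close>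

definition gnp :: "nat \<Rightarrow> real \<Rightarrow> nat ugraph pmf" where
  "gnp n p = map_pmf (\<lambda>b. Ugraph {..<n} {e \<in> all_pairs n. b e})
     (Pi_pmf (all_pairs n) False (\<lambda>_. bernoulli_pmf p))"

definition multiples_at_top :: "nat \<Rightarrow> nat filter" where
  "multiples_at_top k = inf at_top (principal {n. k dvd n})"

end

theory Submission
  imports Defs "HOL-Combinatorics.Permutations" "HOL-Real_Asymp.Real_Asymp"
begin

text \<open>Symmetrising over permutations avoids such a design question: every pair is used the
  same number \<open>N\<close> of times, at the price of rounding the number of matchings per pair
  down to a multiple of \<open>N\<close>. Since \<open>N\<close> depends only on \<open>T\<close>
  and \<open>\<tau>\<close> while \<open>m * p\<close> tends to infinity, the rounding costs a
  negligible share.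

  Acyclicity is needed because the matchings are chosen independently: following them around a cycle
  of classes need not return to the starting vertex, whereas along a tree nothing has to close up.

  The delicate point in probability is that \<open>m * p\<close> may be only of order
  \<open>ln n\<close>, while the condition concerns all \<open>4 ^ m\<close> pairs
  \<open>(S, W)\<close>. For small \<open>S\<close> the failure probability is only about
  \<open>exp (- c * p * m * card S)\<close>, so a crude union bound fails. Pairs with
  \<open>card S + card W \<le> m\<close> satisfy Ore's condition trivially, and for the others the
  number of competing pairs is controlled by the smaller of the two sizes.\<close>

text \<open>Split the \<open>n = \<tau> m\<close> vertices into \<open>\<tau>\<close> classes of size \<open>m\<close>. A Chernoff bound shows that with high
  probability every bipartite graph between two classes satisfies Ore's condition for a \<open>k\<close>-regular
  spanning subgraph with \<open>k \<ge> (1 - 2 \<delta>) m p\<close>, hence contains \<open>k\<close> edge-disjoint perfect matchings. Fix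
  one \<open>T\<close>-factor of the complete graph on the classes. For each permutation of the classes, choosing
  a perfect matching for every edge of the permuted factor yields a \<open>T\<close>-factor of the random graph,
  because \<open>T\<close> has no cycles. All permutations together use each pair of classes equally often, so the
  \<open>k\<close> matchings of each pair can be used up. The edges lost are those inside the classes,
  a \<open>1 / \<tau>\<close> fraction, and an \<open>O(\<delta>)\<close> fraction between classes.\<close>

section \<open>Perfect matchings and regular subgraphs of bipartite graphs\<close>

text \<open>Halmos-Vaughan induction. If some nonempty proper \<open>J\<close> is tight,
  \<open>J\<close> and its complement are served separately; otherwise every such set has a spare
  element, so an arbitrary choice for one index does no harm to the rest.\<close>

lemma hall:
  fixes A :: "'i \<Rightarrow> 'b set"
  assumes "finite I" "\<And>i. i \<in> I \<Longrightarrow> finite (A i)"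
    and "\<And>J. J \<subseteq> I \<Longrightarrow> card J \<le> card (\<Union>(A ` J))"
  shows "\<exists>f. inj_on f I \<and> (\<forall>i\<in>I. f i \<in> A i)"
  using assms
proof (induction "card I" arbitrary: I A rule: less_induct)
  case less
  note finI = \<open>finite I\<close> and finA = less.prems(2) and hall = less.prems(3)
  show ?case
  proof (cases "I = {}")
    case True
    then show ?thesis by simp
  next
    case False
    then obtain i where i: "i \<in> I" by blast
    show ?thesis
    proof (cases "\<exists>J. J \<subseteq> I \<and> J \<noteq> {} \<and> J \<noteq> I \<and> card (\<Union>(A ` J)) \<le> card J")
      case True
      then obtain J where J: "J \<subseteq> I" "J \<noteq> {}" "J \<noteq> I" "card (\<Union>(A ` J)) \<le> card J"
        by blast
      define U where "U = \<Union>(A ` J)"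
      have finJ: "finite J" using J finI finite_subset by blast
      have finU: "finite U" using J finJ finA by (auto simp: U_def)
      have "\<exists>f. inj_on f J \<and> (\<forall>i\<in>J. f i \<in> A i)"
      proof (rule less.hyps)
        show "card J < card I" using J finI by (simp add: psubset_card_mono psubsetI)
      qed (use J finJ finA hall in auto)
      then obtain f where f: "inj_on f J" "\<forall>i\<in>J. f i \<in> A i" by blast
      have "\<exists>g. inj_on g (I - J) \<and> (\<forall>i\<in>I - J. g i \<in> A i - U)"
      proof (rule less.hyps)
        show "card (I - J) < card I" using J finI
          by (intro psubset_card_mono) auto
        \<comment> \<open>\<open>J\<close> and \<open>K\<close> together see at least
          \<open>card J + card K\<close> elements, and tightness of \<open>J\<close> means that at
          most \<open>card J\<close> of them lie in \<open>U\<close>.\<close>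
        show "card K \<le> card (\<Union>i\<in>K. A i - U)" if K: "K \<subseteq> I - J" for K
        proof -
          have finK: "finite K" using K finI finite_subset by blast
          have "card J + card K = card (J \<union> K)"
            using K finJ finK by (intro card_Un_disjoint[symmetric]) auto
          also have "\<dots> \<le> card (\<Union>(A ` (J \<union> K)))"
            using J K by (intro hall) auto
          also have "\<Union>(A ` (J \<union> K)) = U \<union> (\<Union>i\<in>K. A i - U)"
            by (auto simp: U_def)
          also have "card \<dots> \<le> card U + card (\<Union>i\<in>K. A i - U)"
            by (rule card_Un_le)
          finally show ?thesis using J(4) by (simp add: U_def)
        qed
      qed (use finI finA in auto)
      then obtain g where g: "inj_on g (I - J)" "\<forall>i\<in>I - J. g i \<in> A i - U" by blast
      have "inj_on (\<lambda>i. if i \<in> J then f i else g i) I"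
      proof (rule inj_onI)
        fix i j assume ij: "i \<in> I" "j \<in> I" "(if i \<in> J then f i else g i) = (if j \<in> J then f j else g j)"
        have "f i \<in> U" if "i \<in> J" for i using f(2) that by (auto simp: U_def)
        moreover have "g i \<notin> U" if "i \<in> I - J" for i using g(2) that by blast
        ultimately show "i = j" using ij inj_onD[OF f(1), of i j] inj_onD[OF g(1), of i j]
          by (cases "i \<in> J"; cases "j \<in> J") (simp_all, metis+)
      qed
      then show ?thesis using f g by (intro exI[of _ "\<lambda>i. if i \<in> J then f i else g i"]) auto
    next
      case False
      have "card {i} \<le> card (\<Union>(A ` {i}))" using i by (intro hall) blast
      then have "A i \<noteq> {}" by auto
      then obtain x where x: "x \<in> A i" by blast
      have "\<exists>g. inj_on g (I - {i}) \<and> (\<forall>j\<in>I - {i}. g j \<in> A j - {x})"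
      proof (rule less.hyps)
        show "card (I - {i}) < card I" using i finI by (simp add: card_Diff1_less del: card_Diff_insert)
        \<comment> \<open>Without tight sets Hall's inequality is strict on \<open>K\<close>, and
          removing \<open>x\<close> costs at most one element.\<close>
        show "card K \<le> card (\<Union>j\<in>K. A j - {x})" if K: "K \<subseteq> I - {i}" for K
        proof (cases "K = {}")
          case ne: False
          then have "card K < card (\<Union>(A ` K))" using False K i by (metis Diff_iff insertI1 not_le subset_iff)
          moreover have "(\<Union>j\<in>K. A j - {x}) = \<Union>(A ` K) - {x}" by auto
          moreover have "card (\<Union>(A ` K)) \<le> card (\<Union>(A ` K) - {x}) + 1"
            by (metis card_Diff_singleton_if diff_add_inverse2 le_diff_conv le_refl le_add1)
          ultimately show ?thesis by simp
        qed auto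
      qed (use finI finA in auto)
      then obtain g where g: "inj_on g (I - {i})" "\<forall>j\<in>I - {i}. g j \<in> A j - {x}" by blast
      have "x \<notin> g ` (I - {i})" using g(2) by blast
      then have "inj_on (g(i := x)) I"
        using g(1) by (intro inj_onI) (metis Diff_iff fun_upd_apply image_eqI inj_onD singletonD)
      then show ?thesis using g x by (intro exI[of _ "g(i := x)"]) auto
    qed
  qed
qed

lemma card_relation_eq_sum_fst:
  assumes "finite A" "finite E" "E \<subseteq> A \<times> B"
  shows "card E = (\<Sum>a\<in>A. card {b. (a, b) \<in> E})"
proof -
  have "E = (SIGMA a:A. {b. (a, b) \<in> E})" using assms(3) by auto
  moreover have "finite {b. (a, b) \<in> E}" for a
    by (rule finite_subset[of _ "snd ` E"]) (use assms in force)+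
  ultimately show ?thesis using card_SigmaI[of A "\<lambda>a. {b. (a, b) \<in> E}"] assms(1) by simp
qed

lemma card_relation_eq_sum_snd:
  assumes "finite B" "finite E" "E \<subseteq> A \<times> B"
  shows "card E = (\<Sum>b\<in>B. card {a. (a, b) \<in> E})"
proof -
  have "card E = card (prod.swap ` E)" by (simp add: card_image)
  also have "\<dots> = (\<Sum>b\<in>B. card {a. (b, a) \<in> prod.swap ` E})"
    using assms by (intro card_relation_eq_sum_fst[where B = A]) auto
  also have "\<dots> = (\<Sum>b\<in>B. card {a. (a, b) \<in> E})" by (intro sum.cong refl arg_cong[where f = card]) force
  finally show ?thesis .
qed

text \<open>Hall's condition by double counting: the \<open>k * card J\<close> edges leaving
  \<open>J\<close> all end in its neighbourhood, whose vertices absorb at most \<open>k\<close>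
  each.\<close>

lemma regular_bipartite_perfect_matching:
  assumes fin: "finite A" "finite B" and E: "E \<subseteq> A \<times> B" and k: "k > 0"
    and deg: "\<And>a. a \<in> A \<Longrightarrow> card {b. (a, b) \<in> E} = k" "\<And>b. b \<in> B \<Longrightarrow> card {a. (a, b) \<in> E} = k"
  shows "\<exists>f. bij_betw f A B \<and> (\<forall>a\<in>A. (a, f a) \<in> E)"
proof -
  have finE: "finite E" using E fin finite_subset by blast
  have "card E = (\<Sum>a\<in>A. card {b. (a, b) \<in> E})" "card E = (\<Sum>b\<in>B. card {a. (a, b) \<in> E})"
    using card_relation_eq_sum_fst[OF fin(1) finE E] card_relation_eq_sum_snd[OF fin(2) finE E] by auto
  then have AB: "card A = card B" using deg k by simp
  have "\<exists>f. inj_on f A \<and> (\<forall>a\<in>A. f a \<in> {b. (a, b) \<in> E})"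
  proof (rule hall)
    show "finite {b. (a, b) \<in> E}" for a
      by (rule finite_subset[of _ B]) (use fin E in auto)
    show "card J \<le> card (\<Union>a\<in>J. {b. (a, b) \<in> E})" if J: "J \<subseteq> A" for J
    proof -
      define W where "W = (\<Union>a\<in>J. {b. (a, b) \<in> E})"
      have W: "W \<subseteq> B" using E by (auto simp: W_def)
      have finJW: "finite J" "finite W" using J W fin finite_subset by auto
      let ?E = "E \<inter> J \<times> W"
      have "k * card J = (\<Sum>a\<in>J. card {b. (a, b) \<in> E})" using deg J by (simp add: subset_iff)
      also have "\<dots> = (\<Sum>a\<in>J. card {b. (a, b) \<in> ?E})"
        by (intro sum.cong refl arg_cong[where f = card]) (auto simp: W_def)
      also have "\<dots> = card ?E" using finJW finE by (intro card_relation_eq_sum_fst[symmetric]) auto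
      also have "\<dots> = (\<Sum>b\<in>W. card {a. (a, b) \<in> ?E})"
        using finJW finE by (intro card_relation_eq_sum_snd) auto
      also have "\<dots> \<le> (\<Sum>b\<in>W. k)"
      proof (rule sum_mono)
        fix b assume "b \<in> W"
        moreover have "finite {a. (a, b) \<in> E}" by (rule finite_subset[of _ A]) (use fin E in auto)
        then have "card {a. (a, b) \<in> ?E} \<le> card {a. (a, b) \<in> E}" by (intro card_mono) auto
        ultimately show "card {a. (a, b) \<in> ?E} \<le> k" using deg(2) W by auto
      qed
      finally show ?thesis using k by (simp add: W_def mult.commute)
    qed
  qed (use fin in auto)
  then obtain f where f: "inj_on f A" "\<forall>a\<in>A. (a, f a) \<in> E" by auto
  moreover have "f ` A = B"
    using f E fin AB by (intro card_subset_eq) (auto simp: card_image)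
  ultimately show ?thesis by (auto simp: bij_betw_def)
qed

text \<open>Perfect matchings are peeled off one at a time, each lowering all degrees by one. The
  matchings are indexed by an arbitrary finite set because later the indices are the
  \<open>T\<close>-factors that use a given pair of classes.\<close>

lemma regular_bipartite_matching_decomposition:
  assumes "finite I" and fin: "finite A" "finite B" and "card A = card B" and "E \<subseteq> A \<times> B"
    and "\<And>a. a \<in> A \<Longrightarrow> card {b. (a, b) \<in> E} = card I"
    and "\<And>b. b \<in> B \<Longrightarrow> card {a. (a, b) \<in> E} = card I"
  shows "\<exists>f. (\<forall>i\<in>I. bij_betw (f i) A B \<and> (\<forall>a\<in>A. (a, f i a) \<in> E)) \<and>
    (\<forall>i\<in>I. \<forall>j\<in>I. i \<noteq> j \<longrightarrow> (\<forall>a\<in>A. f i a \<noteq> f j a))"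
  using assms(1,5-)
proof (induction I arbitrary: E rule: finite_induct)
  case (insert i I)
  obtain h where h: "bij_betw h A B" "\<forall>a\<in>A. (a, h a) \<in> E"
    using regular_bipartite_perfect_matching[OF fin insert.prems(1) _ insert.prems(2,3)] insert.hyps
    by auto
  define E' where "E' = E - (\<lambda>a. (a, h a)) ` A"
  have "\<exists>f. (\<forall>i\<in>I. bij_betw (f i) A B \<and> (\<forall>a\<in>A. (a, f i a) \<in> E')) \<and>
    (\<forall>i\<in>I. \<forall>j\<in>I. i \<noteq> j \<longrightarrow> (\<forall>a\<in>A. f i a \<noteq> f j a))"
  proof (rule insert.IH)
    show "E' \<subseteq> A \<times> B" using insert.prems by (auto simp: E'_def)
    show "card {b. (a, b) \<in> E'} = card I" if "a \<in> A" for a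
    proof -
      have "{b. (a, b) \<in> E'} = {b. (a, b) \<in> E} - {h a}" using that by (auto simp: E'_def)
      then show ?thesis using insert.prems(2)[OF that] insert.hyps h that by simp
    qed
    show "card {a. (a, b) \<in> E'} = card I" if b: "b \<in> B" for b
    proof -
      obtain a where a: "a \<in> A" "h a = b" using h b by (auto simp: bij_betw_def)
      have "{a. (a, b) \<in> E'} = {a. (a, b) \<in> E} - {a}"
        using a h b by (auto simp: E'_def bij_betw_def inj_on_def)
      then show ?thesis using insert.prems(3)[OF b] insert.hyps h a by auto
    qed
  qed
  then obtain f where f: "\<forall>i\<in>I. bij_betw (f i) A B \<and> (\<forall>a\<in>A. (a, f i a) \<in> E')"
    "\<forall>i\<in>I. \<forall>j\<in>I. i \<noteq> j \<longrightarrow> (\<forall>a\<in>A. f i a \<noteq> f j a)" by (elim exE conjE) (rule that)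
  have fh: "f j a \<noteq> h a" if "j \<in> I" "a \<in> A" for j a
  proof -
    have "(a, f j a) \<in> E'" using f(1) that by blast
    then show ?thesis using that(2) by (force simp: E'_def)
  qed
  show ?case
  proof (intro exI[of _ "f(i := h)"] conjI ballI impI)
    show "(f(i := h)) j a \<noteq> (f(i := h)) j' a"
      if "j \<in> insert i I" "j' \<in> insert i I" "j \<noteq> j'" "a \<in> A" for j j' a
      using that f(2) fh[of j a] fh[of j' a] by (cases "j = i"; cases "j' = i") auto
  qed (use f(1) h in \<open>auto simp: E'_def\<close>)
qed simp

text \<open>Ore's condition for a \<open>k\<close>-regular spanning subgraph. Each edge \<open>e\<close> is subdivided into a path
  \<open>a - Inl e - Inr e - b\<close> and every vertex is replaced by \<open>k\<close> copies; in a perfect matching of the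
  resulting bipartite graph, \<open>e\<close> is chosen iff \<open>Inl e\<close> and \<open>Inr e\<close> are not matched to each other.\<close>

lemma bipartite_regular_spanning_subgraph:
  assumes fin: "finite A" "finite B" and AB: "card A = m" "card B = m" and E: "E \<subseteq> A \<times> B"
    and ore: "\<And>S W. S \<subseteq> A \<Longrightarrow> W \<subseteq> B \<Longrightarrow> k * (card S + card W) \<le> card (E \<inter> S \<times> W) + k * m"
  shows "\<exists>H\<subseteq>E. (\<forall>a\<in>A. card {b. (a, b) \<in> H} = k) \<and> (\<forall>b\<in>B. card {a. (a, b) \<in> H} = k)"
proof -
  have finE: "finite E" using E fin finite_subset by blast
  \<comment> \<open>Left side: copies of \<open>A\<close> and the vertices \<open>Inr e\<close>;
    right side: the vertices \<open>Inl e\<close> and copies of \<open>B\<close>. Both have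
    \<open>k * m + card E\<close> elements, so a matching that saturates \<open>L\<close> is
    perfect.\<close>
  define L :: "(('a \<times> nat) + ('a \<times> 'b)) set" where "L = (A \<times> {..<k}) <+> E"
  define R :: "(('a \<times> 'b) + ('b \<times> nat)) set" where "R = E <+> (B \<times> {..<k})"
  define N :: "('a \<times> nat) + ('a \<times> 'b) \<Rightarrow> (('a \<times> 'b) + ('b \<times> nat)) set" where
    "N = case_sum (\<lambda>(a, i). Inl ` (E \<inter> {a} \<times> B)) (\<lambda>(a, b). insert (Inl (a, b)) (Inr ` ({b} \<times> {..<k})))"
  have finL: "finite L" and finR: "finite R" using fin finE by (auto simp: L_def R_def)
  have cLR: "card L = card R" using fin finE AB by (simp add: L_def R_def card_Plus)
  have NR: "N x \<subseteq> R" if "x \<in> L" for x using that E by (auto simp: N_def L_def R_def)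
  have "\<exists>f. inj_on f L \<and> (\<forall>x\<in>L. f x \<in> N x)"
  proof (rule hall)
    show "finite (N x)" if "x \<in> L" for x using NR[OF that] finR finite_subset by blast
    show "card J \<le> card (\<Union>(N ` J))" if J: "J \<subseteq> L" for J
    proof -
      define S where "S = {a. \<exists>i. Inl (a, i) \<in> J}"
      define Q where "Q = {e. Inr e \<in> J}"
      define W where "W = B - snd ` Q"
      have S: "S \<subseteq> A" and Q: "Q \<subseteq> E" using J by (auto simp: S_def Q_def L_def)
      have finSQ: "finite S" "finite Q" using S Q fin finE finite_subset by auto
      have QB: "snd ` Q \<subseteq> B" using Q E by auto
      have cW: "card W + card (snd ` Q) = m"
        using AB fin QB by (metis W_def card_Diff_subset card_mono finite_subset le_add_diff_inverse2)
      have "J \<subseteq> (S \<times> {..<k}) <+> Q"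
      proof
        fix x assume x: "x \<in> J"
        then show "x \<in> (S \<times> {..<k}) <+> Q"
          using J by (cases x) (auto simp: S_def Q_def L_def)
      qed
      then have "card J \<le> card ((S \<times> {..<k}) <+> Q)" using finSQ by (intro card_mono) auto
      also have "\<dots> = k * card S + card Q" using finSQ by (simp add: card_Plus mult.commute)
      also have "\<dots> \<le> card (E \<inter> S \<times> W) + k * card (snd ` Q) + card Q"
      proof -
        have "k * (card S + card W) \<le> card (E \<inter> S \<times> W) + k * m"
          using S by (intro ore) (auto simp: W_def)
        also have "k * m = k * card W + k * card (snd ` Q)"
          using cW by (metis distrib_left)
        finally show ?thesis by (simp add: distrib_left)
      qed
      also have "\<dots> = card (((E \<inter> S \<times> W) \<union> Q) <+> (snd ` Q \<times> {..<k}))"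
      proof -
        have "card ((E \<inter> S \<times> W) \<union> Q) = card (E \<inter> S \<times> W) + card Q"
          using finE finSQ by (intro card_Un_disjoint) (auto simp: W_def rev_image_eqI)
        then show ?thesis using finE finSQ by (simp add: card_Plus mult.commute)
      qed
      also have "\<dots> \<le> card (\<Union>(N ` J))"
      proof (rule card_mono)
        show "finite (\<Union>(N ` J))" using NR J finR by (meson UN_least finite_subset subset_iff)
        show "((E \<inter> S \<times> W) \<union> Q) <+> (snd ` Q \<times> {..<k}) \<subseteq> \<Union>(N ` J)"
        proof
          fix y assume "y \<in> ((E \<inter> S \<times> W) \<union> Q) <+> (snd ` Q \<times> {..<k})"
          then consider a b where "y = Inl (a, b)" "(a, b) \<in> E" "a \<in> S" "b \<in> W"
            | e where "y = Inl e" "e \<in> Q"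
            | e j where "y = Inr (snd e, j)" "e \<in> Q" "j < k" by blast
          then show "y \<in> \<Union>(N ` J)"
          proof cases
            case 1
            then obtain i where "Inl (a, i) \<in> J" by (auto simp: S_def)
            moreover have "y \<in> N (Inl (a, i))" using 1 E by (auto simp: N_def)
            ultimately show ?thesis by blast
          next
            case 2
            then have "Inr e \<in> J" "y \<in> N (Inr e)" by (auto simp: Q_def N_def split: prod.splits)
            then show ?thesis by blast
          next
            case 3
            then have "Inr e \<in> J" "y \<in> N (Inr e)" by (auto simp: Q_def N_def split: prod.splits)
            then show ?thesis by blast
          qed
        qed
      qed
      finally show ?thesis .
    qed
  qed (rule finL)
  then obtain f where f: "inj_on f L" "\<forall>x\<in>L. f x \<in> N x" by blast
  have surj: "f ` L = R"
    using f NR finR cLR by (intro card_subset_eq) (auto simp: card_image)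
  \<comment> \<open>For an edge \<open>e = (a, b)\<close> of \<open>H\<close>, \<open>Inl e\<close>
    must be matched to one of the \<open>k\<close> copies of \<open>a\<close>, and
    \<open>Inr e\<close> to one of the \<open>k\<close> copies of \<open>b\<close>. As every copy is
    matched, all degrees in \<open>H\<close> are exactly \<open>k\<close>.\<close>
  define H where "H = {e\<in>E. f (Inr e) \<noteq> Inl e}"
  have fl: "\<exists>b. f (Inl (a, i)) = Inl (a, b) \<and> (a, b) \<in> H" if "a \<in> A" "i < k" for a i
  proof -
    have L: "Inl (a, i) \<in> L" using that by (auto simp: L_def)
    then obtain b where b: "f (Inl (a, i)) = Inl (a, b)" "(a, b) \<in> E"
      using f(2) by (fastforce simp: N_def)
    have "Inr (a, b) \<in> L" using b by (simp add: L_def InrI)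
    then have "f (Inr (a, b)) \<noteq> Inl (a, b)"
      using inj_onD[OF f(1), of "Inl (a, i)" "Inr (a, b)"] b L by auto
    then show ?thesis using b by (auto simp: H_def)
  qed
  have fr: "\<exists>j<k. f (Inr (a, b)) = Inr (b, j)" if "(a, b) \<in> H" for a b
  proof -
    have "Inr (a, b) \<in> L" using that by (auto simp: L_def H_def)
    then have "f (Inr (a, b)) \<in> N (Inr (a, b))" using f(2) by blast
    then show ?thesis using that by (auto simp: N_def H_def)
  qed
  have "card {b. (a, b) \<in> H} = k" if a: "a \<in> A" for a
  proof -
    have "{b. (a, b) \<in> H} = (\<lambda>i. snd (projl (f (Inl (a, i))))) ` {..<k}"
    proof (intro equalityI subsetI)
      fix b assume "b \<in> {b. (a, b) \<in> H}"
      then have ab: "(a, b) \<in> E" "f (Inr (a, b)) \<noteq> Inl (a, b)" by (auto simp: H_def)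
      then have "Inl (a, b) \<in> f ` L" unfolding surj by (auto simp: R_def)
      then obtain x where x: "x \<in> L" "f x = Inl (a, b)" by force
      then have "Inl (a, b) \<in> N x" using f(2) by metis
      then obtain i where "x = Inl (a, i)" "i < k"
        using x ab by (cases x) (auto simp: N_def L_def)
      then show "b \<in> (\<lambda>i. snd (projl (f (Inl (a, i))))) ` {..<k}" using x by force
    next
      fix b assume "b \<in> (\<lambda>i. snd (projl (f (Inl (a, i))))) ` {..<k}"
      then show "b \<in> {b. (a, b) \<in> H}" using fl[OF a] by fastforce
    qed
    moreover have "inj_on (\<lambda>i. snd (projl (f (Inl (a, i))))) {..<k}"
    proof (rule inj_onI)
      fix i j assume ij: "i \<in> {..<k}" "j \<in> {..<k}"
        and eq: "snd (projl (f (Inl (a, i)))) = snd (projl (f (Inl (a, j))))"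
      then have "f (Inl (a, i)) = f (Inl (a, j))" using fl[OF a, of i] fl[OF a, of j] by auto
      then show "i = j" using inj_onD[OF f(1), of "Inl (a, i)" "Inl (a, j)"] ij a by (auto simp: L_def intro: InlI)
    qed
    ultimately show ?thesis by (simp add: card_image)
  qed
  moreover have "card {a. (a, b) \<in> H} = k" if b: "b \<in> B" for b
  proof -
    have "bij_betw (\<lambda>a. snd (projr (f (Inr (a, b))))) {a. (a, b) \<in> H} {..<k}"
      unfolding bij_betw_def
    proof
      show "inj_on (\<lambda>a. snd (projr (f (Inr (a, b))))) {a. (a, b) \<in> H}"
      proof (rule inj_onI)
        fix a a' assume a: "a \<in> {a. (a, b) \<in> H}" "a' \<in> {a. (a, b) \<in> H}"
          and eq: "snd (projr (f (Inr (a, b)))) = snd (projr (f (Inr (a', b))))"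
        then have "f (Inr (a, b)) = f (Inr (a', b))" using fr[of a b] fr[of a' b] by auto
        then show "a = a'" using inj_onD[OF f(1), of "Inr (a, b)" "Inr (a', b)"] a
          by (auto simp: L_def H_def)
      qed
      show "(\<lambda>a. snd (projr (f (Inr (a, b))))) ` {a. (a, b) \<in> H} = {..<k}"
      proof (intro equalityI subsetI)
        fix j assume j: "j \<in> {..<k}"
        then have "Inr (b, j) \<in> f ` L" unfolding surj using b by (auto simp: R_def)
        then obtain x where x: "x \<in> L" "f x = Inr (b, j)" by force
        then have "Inr (b, j) \<in> N x" using f(2) by metis
        then obtain a where "x = Inr (a, b)" "(a, b) \<in> E"
          using x by (cases x) (auto simp: N_def L_def)
        then show "j \<in> (\<lambda>a. snd (projr (f (Inr (a, b))))) ` {a. (a, b) \<in> H}"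
          using x by (force simp: H_def)
      next
        fix j assume "j \<in> (\<lambda>a. snd (projr (f (Inr (a, b))))) ` {a. (a, b) \<in> H}"
        then show "j \<in> {..<k}" using fr by fastforce
      qed
    qed
    then show ?thesis using bij_betw_same_card by fastforce
  qed
  ultimately show ?thesis by (intro exI[of _ H]) (auto simp: H_def)
qed

section \<open>Gluing matchings along a tree\<close>

lemma rtranclp_distinct_path:
  assumes "R\<^sup>*\<^sup>* x y"
  shows "\<exists>xs. xs \<noteq> [] \<and> hd xs = x \<and> last xs = y \<and> distinct xs \<and> successively R xs"
  using assms
proof (induction rule: rtranclp_induct)
  case base
  then show ?case by (intro exI[of _ "[x]"]) auto
next
  case (step y z)
  then obtain xs where xs: "xs \<noteq> []" "hd xs = x" "last xs = y" "distinct xs" "successively R xs"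
    by blast
  show ?case
  proof (cases "z \<in> set xs")
    case True
    then obtain as bs where "xs = as @ z # bs" by (meson split_list)
    then show ?thesis using xs
      by (intro exI[of _ "as @ [z]"]) (auto simp: successively_append_iff hd_append)
  next
    case False
    then show ?thesis using xs step.hyps
      by (intro exI[of _ "xs @ [z]"]) (auto simp: successively_append_iff)
  qed
qed

lemma successively_nth:
  "successively R xs \<Longrightarrow> Suc i < length xs \<Longrightarrow> R (xs ! i) (xs ! Suc i)"
  by (auto simp: successively_conv_nth)

lemma rtranclp_crossing:
  assumes "R\<^sup>*\<^sup>* x y" "x \<in> S" "y \<notin> S"
  shows "\<exists>u v. u \<in> S \<and> v \<notin> S \<and> R u v \<and> R\<^sup>*\<^sup>* x v"
  using assms by (induction rule: rtranclp_induct) (blast intro: rtranclp.rtrancl_into_rtrancl)+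

lemma adj_sym: "adj G u v \<Longrightarrow> adj G v u"
  by (simp add: adj_def insert_commute)

text \<open>Two different neighbours of \<open>v\<close> in \<open>S\<close>, joined by a path
  inside \<open>S\<close>, would close a cycle through \<open>v\<close>. This is the only place
  where acyclicity enters.\<close>

lemma tree_unique_neighbour:
  assumes T: "is_tree T" and S: "S \<subseteq> verts T"
    and conn: "(\<lambda>a b. adj T a b \<and> a \<in> S \<and> b \<in> S)\<^sup>*\<^sup>* u w"
    and u: "u \<in> S" "adj T u v" and w: "w \<in> S" "adj T w v" and v: "v \<in> verts T" "v \<notin> S"
  shows "w = u"
proof (rule ccontr)
  assume "w \<noteq> u"
  let ?R = "\<lambda>a b. adj T a b \<and> a \<in> S \<and> b \<in> S"
  obtain xs where xs: "xs \<noteq> []" "hd xs = u" "last xs = w" "distinct xs" "successively ?R xs"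
    using rtranclp_distinct_path[OF conn] by blast
  have len: "length xs \<ge> 2"
    using xs \<open>w \<noteq> u\<close> by (cases xs rule: remdups_adj.cases) auto
  have "set xs \<subseteq> S"
  proof
    fix x assume "x \<in> set xs"
    then obtain i where i: "i < length xs" "x = xs ! i" by (auto simp: in_set_conv_nth)
    show "x \<in> S"
    proof (cases "i = 0")
      case True
      then show ?thesis using i xs u by (simp add: hd_conv_nth)
    next
      case False
      then show ?thesis using successively_nth[OF xs(5), of "i - 1"] i by simp
    qed
  qed
  \<comment> \<open>The path is distinct, avoids \<open>v\<close> because it stays in
    \<open>S\<close>, and has at least two vertices, so the cycle has the required length 3.\<close>
  then have "is_cycle T (v # xs)"
    unfolding is_cycle_def
  proof (intro conjI allI impI)
    fix i assume i: "i < length (v # xs)"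
    consider "i = 0" | "i = length xs" | "0 < i" "i < length xs" using i by fastforce
    then show "adj T ((v # xs) ! i) ((v # xs) ! (Suc i mod length (v # xs)))"
    proof cases
      case 1
      then show ?thesis using len xs u adj_sym[OF u(2)] by (simp add: hd_conv_nth[symmetric])
    next
      case 2
      then show ?thesis using xs w by (simp add: last_conv_nth nth_Cons')
    next
      case 3
      then show ?thesis using successively_nth[OF xs(5), of "i - 1"] by (simp add: nth_Cons')
    qed
  qed (use len xs S v in auto)
  then show False using T by (auto simp: is_tree_def)
qed

text \<open>A tree grows from a root by attaching leaves: each new vertex has exactly one neighbour
  among the earlier ones.\<close>

lemma tree_induct:
  assumes T: "is_tree T" and r: "r \<in> verts T" "P {r}"
    and step: "\<And>S u v. \<lbrakk>S \<subseteq> verts T; u \<in> S; v \<in> verts T - S; adj T u v;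
      \<And>w. w \<in> S \<Longrightarrow> adj T w v \<Longrightarrow> w = u; P S\<rbrakk> \<Longrightarrow> P (insert v S)"
  shows "P (verts T)"
proof -
  let ?R = "\<lambda>S a b. adj T a b \<and> a \<in> S \<and> b \<in> S"
  \<comment> \<open>Besides \<open>P\<close>, the invariant keeps \<open>S\<close> connected by
    paths inside \<open>S\<close>; \<open>tree_unique_neighbour\<close> needs such a path between
    two neighbours of the new vertex.\<close>
  define good where "good S \<longleftrightarrow> S \<subseteq> verts T \<and> r \<in> S \<and> P S \<and> (\<forall>x\<in>S. (?R S)\<^sup>*\<^sup>* r x)" for S
  have fin: "finite (verts T)" using T by (auto simp: is_tree_def simple_graph_def)
  have extend: "\<exists>S'. good S' \<and> card S < card S'" if S: "good S" "S \<noteq> verts T" for S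
  proof -
    have ST: "S \<subseteq> verts T" and rS: "r \<in> S" and PS: "P S" and cS: "\<And>x. x \<in> S \<Longrightarrow> (?R S)\<^sup>*\<^sup>* r x"
      using S(1) by (auto simp: good_def)
    obtain z where z: "z \<in> verts T" "z \<notin> S" using S(2) ST by blast
    have "(adj T)\<^sup>*\<^sup>* r z" using T r z by (auto simp: is_tree_def graph_connected_def)
    then obtain u v where uv: "u \<in> S" "v \<notin> S" "adj T u v"
      using rtranclp_crossing[of "adj T" r z S] z rS by blast
    have v: "v \<in> verts T" using uv T by (auto simp: is_tree_def simple_graph_def adj_def)
    have uniq: "w = u" if w: "w \<in> S" "adj T w v" for w
    proof -
      have "symp (?R S)" by (auto intro!: sympI adj_sym)
      then have "(?R S)\<^sup>*\<^sup>* u r" using cS[OF uv(1)] by (rule sympD[OF symp_rtranclp])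
      moreover have "(?R S)\<^sup>*\<^sup>* r w" using w by (intro cS)
      ultimately have "(?R S)\<^sup>*\<^sup>* u w" by (rule rtranclp_trans)
      then show ?thesis using uv w v by (intro tree_unique_neighbour[OF T ST])
    qed
    have "good (insert v S)"
      unfolding good_def
    proof (intro conjI ballI)
      show "P (insert v S)" by (rule step[OF ST uv(1) _ uv(3) uniq PS]) (use uv v in auto)
      have mono: "(?R (insert v S))\<^sup>*\<^sup>* r x" if "x \<in> S" for x
        by (rule mono_rtranclp[rule_format, OF _ cS[OF that]]) auto
      show "(?R (insert v S))\<^sup>*\<^sup>* r x" if "x \<in> insert v S" for x
      proof (cases "x = v")
        case True
        show ?thesis unfolding True
          by (rule rtranclp.rtrancl_into_rtrancl[OF mono[OF uv(1)]]) (use uv in auto)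
      qed (use that mono in auto)
    qed (use ST rS v in auto)
    moreover have "finite S" using ST fin finite_subset by blast
    ultimately show ?thesis using uv by (intro exI[of _ "insert v S"]) auto
  qed
  have "good {r}" using r by (auto simp: good_def)
  \<comment> \<open>Instead of an induction on size, a good set of largest cardinality is taken; it
    cannot be extended, so it is all of \<open>verts T\<close>.\<close>
  moreover have bounded: "\<forall>S. good S \<longrightarrow> card S < Suc (card (verts T))"
    using fin by (auto simp: good_def intro: card_mono le_imp_less_Suc)
  ultimately obtain S where S: "good S" "\<forall>S'. good S' \<longrightarrow> card S' \<le> card S"
    using ex_has_greatest_nat[of good "{r}" card "Suc (card (verts T))"] by (auto simp: less_imp_le)
  then have "S = verts T" using extend[OF S(1)] by fastforce
  then show ?thesis using S by (auto simp: good_def)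
qed

text \<open>Labels \<open>a < m\<close> are transported from the root along the matchings. A new
  vertex has a single earlier neighbour, so no two transports can conflict. For fixed
  \<open>a\<close> the vertices \<open>h u a\<close> are the \<open>a\<close>-th copy of
  \<open>T\<close>.\<close>

lemma tree_coherent_bijections:
  assumes T: "is_tree T"
    and X: "\<And>u. u \<in> verts T \<Longrightarrow> finite (V u) \<and> card (V u) = m"
    and g: "\<And>u v a. {u, v} \<in> edges T \<Longrightarrow> a \<in> V u \<Longrightarrow> g {u, v} a \<in> V v \<and> g {u, v} (g {u, v} a) = a"
  shows "\<exists>h. (\<forall>u\<in>verts T. bij_betw (h u) {..<m} (V u)) \<and>
    (\<forall>u v a. {u, v} \<in> edges T \<longrightarrow> a < m \<longrightarrow> h v a = g {u, v} (h u a))"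
proof -
  have simple: "\<And>e. e \<in> edges T \<Longrightarrow> e \<subseteq> verts T \<and> card e = 2"
    using T by (auto simp: is_tree_def simple_graph_def)
  define P where "P S \<longleftrightarrow> (\<exists>h. (\<forall>u\<in>S. bij_betw (h u) {..<m} (V u)) \<and>
    (\<forall>u\<in>S. \<forall>v\<in>S. {u, v} \<in> edges T \<longrightarrow> (\<forall>a<m. h v a = g {u, v} (h u a))))" for S
  obtain r where r: "r \<in> verts T" using T by (auto simp: is_tree_def graph_connected_def)
  have loop: "{v, v} \<notin> edges T" for v using simple[of "{v, v}"] by auto
  have "P (verts T)"
  proof (rule tree_induct[OF T r])
    obtain b where "bij_betw b {..<m} (V r)"
      using finite_same_card_bij[of "{..<m}" "V r"] X[OF r] by auto
    then show "P {r}" unfolding P_def using loop by (intro exI[of _ "\<lambda>_. b"]) auto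
  next
    fix S u v
    assume S: "S \<subseteq> verts T" and u: "u \<in> S" and v: "v \<in> verts T - S" and uv: "adj T u v"
      and uniq: "\<And>w. w \<in> S \<Longrightarrow> adj T w v \<Longrightarrow> w = u" and "P S"
    then obtain h where h: "\<forall>u\<in>S. bij_betw (h u) {..<m} (V u)"
      "\<forall>u\<in>S. \<forall>v\<in>S. {u, v} \<in> edges T \<longrightarrow> (\<forall>a<m. h v a = g {u, v} (h u a))"
      unfolding P_def by blast
    have e: "{u, v} \<in> edges T" "{v, u} \<in> edges T" using uv adj_sym[OF uv] by (auto simp: adj_def)
    let ?h = "h(v := \<lambda>a. g {u, v} (h u a))"
    have "bij_betw (g {u, v}) (V u) (V v)"
      using g[OF e(1)] g[OF e(2)]
      by (intro bij_betw_byWitness[of _ "g {u, v}"]) (auto simp: insert_commute)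
    then have "bij_betw (g {u, v} \<circ> h u) {..<m} (V v)"
      using h(1) u bij_betw_trans by blast
    then have 1: "\<forall>w\<in>insert v S. bij_betw (?h w) {..<m} (V w)" using h(1) by (auto simp: comp_def)
    have "?h y a = g {x, y} (?h x a)"
      if xy: "x \<in> insert v S" "y \<in> insert v S" "{x, y} \<in> edges T" "a < m" for x y a
    proof -
      have "adj T x y" using xy(3) by (simp add: adj_def)
      moreover have "x \<noteq> y" using loop xy(3) by metis
      ultimately consider "x \<in> S" "y \<in> S" | "x = v" "y = u" | "x = u" "y = v"
        using xy(1,2) uniq[of x] uniq[of y] adj_sym[of T x y] by blast
      then show ?thesis
      proof cases
        case 1
        then have "x \<noteq> v" "y \<noteq> v" using v by blast+
        then show ?thesis using h(2)[rule_format, OF 1 xy(3,4)] by simp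
      next
        case 2
        \<comment> \<open>The edge is read from the new vertex back to its parent; here it matters
          that \<open>g {u, v}\<close> is an involution.\<close>
        have "h u a \<in> V u" using h(1) u xy by (auto simp: bij_betw_def)
        then show ?thesis using g[OF e(1)] 2 u v by (auto simp: insert_commute)
      next
        case 3
        then show ?thesis using u v by auto
      qed
    qed
    then show "P (insert v S)" unfolding P_def using 1 by blast
  qed
  then obtain h where h: "\<forall>u\<in>verts T. bij_betw (h u) {..<m} (V u)"
    "\<forall>u\<in>verts T. \<forall>v\<in>verts T. {u, v} \<in> edges T \<longrightarrow> (\<forall>a<m. h v a = g {u, v} (h u a))"
    unfolding P_def by blast
  then show ?thesis using simple by (intro exI[of _ h]) blast
qed

text \<open>A perfect matching between the classes \<open>V x\<close> and \<open>V y\<close> is represented by an involution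
  exchanging them, which makes the representation symmetric in \<open>x\<close> and \<open>y\<close>.\<close>

definition matching_on :: "('i \<Rightarrow> 'v set) \<Rightarrow> 'i set \<Rightarrow> ('v \<Rightarrow> 'v) \<Rightarrow> bool" where
  "matching_on V f g \<longleftrightarrow> (\<forall>x y. f = {x, y} \<longrightarrow> (\<forall>a\<in>V x. g a \<in> V y \<and> g (g a) = a))"

text \<open>Every edge is listed from both of its ends, which keeps the definition symmetric in the
  two classes; \<open>matching_edges_eq\<close> returns to one side.\<close>

definition matching_edges :: "('i \<Rightarrow> 'v set) \<Rightarrow> 'i set \<Rightarrow> ('v \<Rightarrow> 'v) \<Rightarrow> 'v set set" where
  "matching_edges V f g = (\<lambda>a. {a, g a}) ` (\<Union>x\<in>f. V x)"

text \<open>\<open>\<psi> (j, u)\<close> is the class that plays the vertex \<open>u\<close> in the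
  \<open>j\<close>-th copy of \<open>T\<close> on the classes. Only the pairs of classes carrying an
  edge are recorded, since these are what the matchings are attached to.\<close>

definition tree_copies :: "(nat \<times> 'a \<Rightarrow> 'i) \<Rightarrow> nat \<Rightarrow> 'a ugraph \<Rightarrow> 'i set set" where
  "tree_copies \<psi> q T = (\<Union>j<q. (\<lambda>e. (\<lambda>u. \<psi> (j, u)) ` e) ` edges T)"

text \<open>A blow-up: each of the \<open>q\<close> copies of \<open>T\<close> on the classes turns
  into \<open>m\<close> disjoint copies in \<open>G\<close>. The factor uses every edge of the
  chosen matchings, so no edge of a matching is lost.\<close>

lemma tree_factor_of_matchings:
  assumes T: "is_tree T" and \<psi>: "bij_betw \<psi> ({..<q} \<times> verts T) I"
    and V: "disjoint_family_on V I" "\<And>x. x \<in> I \<Longrightarrow> finite (V x) \<and> card (V x) = m"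
    and G: "verts G = (\<Union>x\<in>I. V x)"
    and g: "\<And>f. f \<in> tree_copies \<psi> q T \<Longrightarrow> matching_on V f (g f) \<and> matching_edges V f (g f) \<subseteq> edges G"
  shows "\<exists>F. graph_factor T G F \<and>
    factor_edges F = (\<Union>f\<in>tree_copies \<psi> q T. matching_edges V f (g f))"
proof -
  have simple: "\<And>e. e \<in> edges T \<Longrightarrow> e \<subseteq> verts T \<and> card e = 2" and finT: "finite (verts T)"
    and neT: "verts T \<noteq> {}"
    using T by (auto simp: is_tree_def simple_graph_def graph_connected_def)
  have \<psi>I: "\<psi> (j, u) \<in> I" if "j < q" "u \<in> verts T" for j u
    using \<psi> that by (auto simp: bij_betw_def)
  have pair: "\<exists>u v. e = {u, v} \<and> u \<in> verts T \<and> v \<in> verts T" if "e \<in> edges T" for e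
    using simple[OF that] by (auto simp: card_2_iff)
  have copy: "(\<lambda>u. \<psi> (j, u)) ` e \<in> tree_copies \<psi> q T" if "j < q" "e \<in> edges T" for j e
    using that by (auto simp: tree_copies_def)
  have "\<exists>h. (\<forall>u\<in>verts T. bij_betw (h u) {..<m} (V (\<psi> (j, u)))) \<and>
    (\<forall>u v a. {u, v} \<in> edges T \<longrightarrow> a < m \<longrightarrow> h v a = g {\<psi> (j, u), \<psi> (j, v)} (h u a))"
    if j: "j < q" for j
  proof -
    have "\<exists>h. (\<forall>u\<in>verts T. bij_betw (h u) {..<m} (V (\<psi> (j, u)))) \<and>
      (\<forall>u v a. {u, v} \<in> edges T \<longrightarrow> a < m \<longrightarrow> h v a = g ((\<lambda>u. \<psi> (j, u)) ` {u, v}) (h u a))"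
    proof (rule tree_coherent_bijections[OF T])
      fix u v a assume uv: "{u, v} \<in> edges T" "a \<in> V (\<psi> (j, u))"
      have "matching_on V ((\<lambda>u. \<psi> (j, u)) ` {u, v}) (g ((\<lambda>u. \<psi> (j, u)) ` {u, v}))"
        using g[OF copy[OF j uv(1)]] by blast
      then show "g ((\<lambda>u. \<psi> (j, u)) ` {u, v}) a \<in> V (\<psi> (j, v)) \<and>
        g ((\<lambda>u. \<psi> (j, u)) ` {u, v}) (g ((\<lambda>u. \<psi> (j, u)) ` {u, v}) a) = a"
        unfolding matching_on_def using uv(2) by auto
    qed (use V \<psi>I j in auto)
    then show ?thesis by simp
  qed
  then obtain H where H: "\<And>j u. j < q \<Longrightarrow> u \<in> verts T \<Longrightarrow> bij_betw (H j u) {..<m} (V (\<psi> (j, u)))"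
    "\<And>j u v a. j < q \<Longrightarrow> {u, v} \<in> edges T \<Longrightarrow> a < m \<Longrightarrow> H j v a = g {\<psi> (j, u), \<psi> (j, v)} (H j u a)"
    by metis
  have HV: "H j u a \<in> V (\<psi> (j, u))" if "j < q" "u \<in> verts T" "a < m" for j u a
    using H(1)[OF that(1,2)] that(3) by (auto simp: bij_betw_def)
  \<comment> \<open>A vertex determines its class, hence \<open>(j, u)\<close> through
    \<open>\<psi>\<close>, and then its label \<open>a\<close>. All disjointness of copies comes
    from this.\<close>
  have Hinj: "j = j' \<and> u = u' \<and> a = a'"
    if "j < q" "u \<in> verts T" "a < m" "j' < q" "u' \<in> verts T" "a' < m" "H j u a = H j' u' a'"
    for j u a j' u' a'
  proof -
    have "\<psi> (j, u) = \<psi> (j', u')"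
      using HV[OF that(1-3)] HV[OF that(4-6)] that V(1) \<psi>I
      by (auto simp: disjoint_family_on_def)
    then have "j = j' \<and> u = u'"
      using \<psi> that inj_onD[of \<psi> "{..<q} \<times> verts T" "(j, u)" "(j', u')"] by (auto simp: bij_betw_def)
    then show ?thesis using H(1)[OF that(1,2)] that by (auto simp: bij_betw_def inj_on_def)
  qed
  \<comment> \<open>\<open>c (j, a)\<close> takes one vertex from each class of the
    \<open>j\<close>-th copy, namely the one labelled \<open>a\<close>.\<close>
  define c where "c = (\<lambda>(j, a). Ugraph ((\<lambda>u. H j u a) ` verts T) ((\<lambda>e. (\<lambda>u. H j u a) ` e) ` edges T))"
  define F where "F = c ` ({..<q} \<times> {..<m})"
  have inj: "inj_on (\<lambda>u. H j u a) (verts T)" if "j < q" "a < m" for j a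
    using Hinj that by (auto simp: inj_on_def)
  have edge: "(\<lambda>u. H j u a) ` {u, v} = {b, g f b}"
    if "j < q" "a < m" "{u, v} \<in> edges T" "b = H j u a" "f = (\<lambda>u. \<psi> (j, u)) ` {u, v}" for j a u v b f
    using H(2)[of j u v a] that by auto
  have edges_c: "edges (c (j, a)) \<subseteq> (\<Union>f\<in>tree_copies \<psi> q T. matching_edges V f (g f))"
    if ja: "j < q" "a < m" for j a
  proof
    fix e' assume "e' \<in> edges (c (j, a))"
    then obtain e where e: "e \<in> edges T" "e' = (\<lambda>u. H j u a) ` e" by (auto simp: c_def)
    obtain u v where uv: "e = {u, v}" "u \<in> verts T" using pair[OF e(1)] by blast
    let ?f = "(\<lambda>u. \<psi> (j, u)) ` {u, v}"
    have "e' = {H j u a, g ?f (H j u a)}" using edge[OF ja, of u v] e uv by blast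
    then have "e' \<in> matching_edges V ?f (g ?f)"
      using HV[OF ja(1) uv(2) ja(2)] by (auto simp: matching_edges_def)
    then show "e' \<in> (\<Union>f\<in>tree_copies \<psi> q T. matching_edges V f (g f))"
      using copy[OF ja(1) e(1)] uv by blast
  qed
  have sub: "subgraph_of (c (j, a)) G" if ja: "j < q" "a < m" for j a
    unfolding subgraph_of_def simple_graph_def
  proof (intro conjI ballI)
    show "verts (c (j, a)) \<subseteq> verts G" using HV[OF ja(1) _ ja(2)] \<psi>I[OF ja(1)] by (auto simp: c_def G)
    show "edges (c (j, a)) \<subseteq> edges G" using edges_c[OF ja] g by blast
    fix e' assume "e' \<in> edges (c (j, a))"
    then obtain e where e: "e \<in> edges T" "e' = (\<lambda>u. H j u a) ` e" by (auto simp: c_def)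
    then show "e' \<subseteq> verts (c (j, a))" using simple[OF e(1)] by (auto simp: c_def)
    show "card e' = 2" using simple[OF e(1)] e inj[OF ja] by (metis card_image inj_on_subset)
  qed (use finT in \<open>auto simp: c_def\<close>)
  have iso: "isomorphic (c (j, a)) T" if ja: "j < q" "a < m" for j a
    unfolding isomorphic_def
  proof (intro exI[of _ "inv_into (verts T) (\<lambda>u. H j u a)"] conjI ballI)
    show "bij_betw (inv_into (verts T) (\<lambda>u. H j u a)) (verts (c (j, a))) (verts T)"
      using inj_on_imp_bij_betw[OF inj[OF ja]] by (auto simp: c_def intro: bij_betw_inv_into)
    fix x y assume "x \<in> verts (c (j, a))" "y \<in> verts (c (j, a))"
    then obtain u v where uv: "u \<in> verts T" "v \<in> verts T" "x = H j u a" "y = H j v a"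
      by (auto simp: c_def)
    have "{x, y} \<in> edges (c (j, a)) \<longleftrightarrow> (\<exists>e\<in>edges T. (\<lambda>u. H j u a) ` {u, v} = (\<lambda>u. H j u a) ` e)"
      by (auto simp: c_def uv image_iff)
    also have "\<dots> \<longleftrightarrow> {u, v} \<in> edges T"
      using inj_on_image_eq_iff[OF inj[OF ja], of "{u, v}"] uv simple by blast
    finally show "adj (c (j, a)) x y \<longleftrightarrow>
      adj T (inv_into (verts T) (\<lambda>u. H j u a) x) (inv_into (verts T) (\<lambda>u. H j u a) y)"
      using inv_into_f_f[OF inj[OF ja] uv(1)] inv_into_f_f[OF inj[OF ja] uv(2)] uv(3,4)
      by (simp add: adj_def)
  qed
  have disj: "disjnt (verts (c (j, a))) (verts (c (j', a')))"
    if "j < q" "a < m" "j' < q" "a' < m" "(j, a) \<noteq> (j', a')" for j a j' a'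
    using Hinj that by (auto simp: c_def disjnt_def)
  \<comment> \<open>Nonemptiness turns disjointness of the copies into injectivity of
    \<open>c\<close>, so that \<open>F\<close> really has \<open>q * m\<close> members.\<close>
  have nec: "verts (c ja) \<noteq> {}" for ja using neT by (auto simp: c_def split: prod.splits)
  have "inj_on c ({..<q} \<times> {..<m})"
  proof (rule inj_onI)
    fix x y assume xy: "x \<in> {..<q} \<times> {..<m}" "y \<in> {..<q} \<times> {..<m}" "c x = c y"
    then have "\<not> disjnt (verts (c x)) (verts (c y))" using nec[of x] by (simp add: disjnt_def)
    moreover obtain j a j' a' where "x = (j, a)" "y = (j', a')" by (cases x, cases y)
    ultimately show "x = y" using disj[of j a j' a'] xy(1,2) by blast
  qed
  then have cF: "card F = q * m" by (simp add: F_def card_image)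
  have finI: "finite I" and cI: "card I = q * card (verts T)"
    using \<psi> finT bij_betw_finite[OF \<psi>] bij_betw_same_card[OF \<psi>] by auto
  have "card (verts G) = (\<Sum>x\<in>I. card (V x))"
    unfolding G using finI V by (intro card_UN_disjoint) (auto simp: disjoint_family_on_def)
  then have "card F * card (verts T) = card (verts G)" using V cF cI by simp
  then have "graph_factor T G F"
    unfolding graph_factor_def F_def
  proof (intro conjI pairwise_imageI)
    fix x y assume "x \<in> {..<q} \<times> {..<m}" "y \<in> {..<q} \<times> {..<m}" "x \<noteq> y"
    moreover obtain j a j' a' where "x = (j, a)" "y = (j', a')" by (cases x, cases y)
    ultimately show "disjnt (verts (c x)) (verts (c y))" using disj[of j a j' a'] by blast
  qed (use sub iso in auto)
  moreover have "factor_edges F = (\<Union>f\<in>tree_copies \<psi> q T. matching_edges V f (g f))"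
  proof (intro equalityI subsetI)
    fix e' assume "e' \<in> factor_edges F"
    then show "e' \<in> (\<Union>f\<in>tree_copies \<psi> q T. matching_edges V f (g f))"
      unfolding factor_edges_def F_def using edges_c by blast
  next
    fix e' assume "e' \<in> (\<Union>f\<in>tree_copies \<psi> q T. matching_edges V f (g f))"
    then obtain j e x b where e: "j < q" "e \<in> edges T" "x \<in> (\<lambda>u. \<psi> (j, u)) ` e" "b \<in> V x"
      "e' = {b, g ((\<lambda>u. \<psi> (j, u)) ` e) b}"
      unfolding tree_copies_def matching_edges_def by blast
    then obtain u where u: "u \<in> e" "x = \<psi> (j, u)" by blast
    obtain v where v: "e = {u, v}" "u \<in> verts T" using pair[OF e(2)] u by (auto simp: insert_commute)
    obtain a where a: "a < m" "b = H j u a"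
      using H(1)[OF e(1) v(2)] e(4) u(2) by (auto simp: bij_betw_def)
    have "e' = (\<lambda>u. H j u a) ` e" using edge[OF e(1) a(1), of u v] e v a by simp
    then have "e' \<in> edges (c (j, a))" using e(2) by (auto simp: c_def)
    then show "e' \<in> factor_edges F" using e(1) a(1) by (auto simp: factor_edges_def F_def)
  qed
  ultimately show ?thesis by blast
qed

section \<open>Edge counts for families of factors built from matchings\<close>

lemma matching_onD:
  assumes "matching_on V {x, y} g" "a \<in> V x"
  shows "g a \<in> V y" "g (g a) = a"
  using matching_on_def[THEN iffD1, rule_format, OF assms(1) refl assms(2)] by simp_all

lemma matching_edges_eq:
  assumes "matching_on V {x, y} g"
  shows "matching_edges V {x, y} g = (\<lambda>a. {a, g a}) ` V x"
proof -
  have g: "a \<in> V x \<Longrightarrow> g a \<in> V y \<and> g (g a) = a" "a \<in> V y \<Longrightarrow> g a \<in> V x \<and> g (g a) = a" for a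
    using matching_onD[OF assms, of a] matching_onD[of V y x g a] assms by (simp_all add: insert_commute)
  show ?thesis
  proof (intro equalityI subsetI)
    fix e assume "e \<in> matching_edges V {x, y} g"
    then obtain a where a: "e = {a, g a}" "a \<in> V x \<or> a \<in> V y" by (auto simp: matching_edges_def)
    show "e \<in> (\<lambda>a. {a, g a}) ` V x"
    proof (cases "a \<in> V x")
      case False
      then have "e = {g a, g (g a)}" "g a \<in> V x" using a g(2)[of a] by auto
      then show ?thesis by blast
    qed (use a in auto)
  qed (auto simp: matching_edges_def)
qed

lemma card_matching_edges:
  assumes g: "matching_on V {x, y} g" and "V x \<inter> V y = {}"
  shows "card (matching_edges V {x, y} g) = card (V x)"
proof -
  have "g a \<in> V y" if "a \<in> V x" for a using matching_onD[OF g that] by blast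
  then have "inj_on (\<lambda>a. {a, g a}) (V x)"
    using assms(2) by (auto simp: inj_on_def doubleton_eq_iff)
  then show ?thesis by (simp add: matching_edges_eq[OF g] card_image)
qed

text \<open>An edge of a matching determines its pair of classes: they are exactly the classes that
  it meets.\<close>

lemma matching_edges_disjoint_classes:
  assumes V: "disjoint_family_on V I" and f: "f \<subseteq> I" "card f = 2" and f': "f' \<subseteq> I" "card f' = 2"
    and g: "matching_on V f g" and g': "matching_on V f' g'" and "f \<noteq> f'"
  shows "matching_edges V f g \<inter> matching_edges V f' g' = {}"
proof -
  have same: "x = y" if "a \<in> V x" "a \<in> V y" "x \<in> I" "y \<in> I" for a x y
    using V that by (auto simp: disjoint_family_on_def)
  have classes: "f = {x. x \<in> I \<and> e \<inter> V x \<noteq> {}}"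
    if f: "f \<subseteq> I" "card f = 2" and g: "matching_on V f g" and e: "e \<in> matching_edges V f g" for f g e
  proof -
    obtain x y where xy: "f = {x, y}" using f by (auto simp: card_2_iff)
    then obtain a where a: "e = {a, g a}" "a \<in> V x" using e unfolding xy matching_edges_eq[OF g[unfolded xy]] by auto
    then have "g a \<in> V y" using matching_onD(1)[OF g[unfolded xy]] by blast
    show ?thesis
    proof (intro equalityI subsetI)
      fix z assume "z \<in> f"
      then show "z \<in> {x. x \<in> I \<and> e \<inter> V x \<noteq> {}}" using xy f a \<open>g a \<in> V y\<close> by blast
    next
      fix z assume "z \<in> {x. x \<in> I \<and> e \<inter> V x \<noteq> {}}"
      then have "z \<in> I" "a \<in> V z \<or> g a \<in> V z" using a by auto
      moreover have "x \<in> I" "y \<in> I" using xy f by auto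
      ultimately show "z \<in> f" using same[of a x z] same[of "g a" y z] a \<open>g a \<in> V y\<close> xy by blast
    qed
  qed
  show ?thesis
  proof (rule ccontr)
    assume "matching_edges V f g \<inter> matching_edges V f' g' \<noteq> {}"
    then obtain e where "e \<in> matching_edges V f g" "e \<in> matching_edges V f' g'" by blast
    from classes[OF f g this(1)] classes[OF f' g' this(2)] show False
      using \<open>f \<noteq> f'\<close> by simp
  qed
qed

lemma tree_copies_pairs:
  assumes T: "is_tree T" and \<psi>: "bij_betw \<psi> ({..<q} \<times> verts T) I" and f: "f \<in> tree_copies \<psi> q T"
  shows "f \<subseteq> I \<and> card f = 2"
proof -
  obtain j e where e: "j < q" "e \<in> edges T" "f = (\<lambda>u. \<psi> (j, u)) ` e"
    using f by (auto simp: tree_copies_def)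
  have "e \<subseteq> verts T" "card e = 2" using T e by (auto simp: is_tree_def simple_graph_def)
  moreover have "inj_on (\<lambda>u. \<psi> (j, u)) (verts T)"
    using \<psi> e(1) by (auto simp: bij_betw_def inj_on_def)
  ultimately show ?thesis using \<psi> e by (auto simp: bij_betw_def inj_on_subset card_image)
qed

lemma finite_tree_copies: "is_tree T \<Longrightarrow> finite (tree_copies \<psi> q T)"
proof -
  assume "is_tree T"
  then have "finite (edges T)"
    by (intro finite_subset[of "edges T" "Pow (verts T)"]) (auto simp: is_tree_def simple_graph_def)
  then show ?thesis by (simp add: tree_copies_def)
qed

text \<open>\<open>g f i\<close> is the matching on the pair \<open>f\<close> reserved for the
  factor \<open>i\<close>. Disjointness has to be assumed only within one pair \<open>f\<close>;
  across different pairs it is automatic. Each incidence of a factor with a pair covers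
  \<open>m\<close> edges.\<close>

lemma tree_factors_of_matchings:
  assumes T: "is_tree T" and fin: "finite J" "finite I"
    and \<psi>: "\<And>i. i \<in> J \<Longrightarrow> bij_betw (\<psi> i) ({..<q} \<times> verts T) I"
    and V: "disjoint_family_on V I" "\<And>x. x \<in> I \<Longrightarrow> finite (V x) \<and> card (V x) = m"
    and G: "verts G = (\<Union>x\<in>I. V x)"
    and g: "\<And>i f. i \<in> J \<Longrightarrow> f \<in> tree_copies (\<psi> i) q T \<Longrightarrow>
      matching_on V f (g f i) \<and> matching_edges V f (g f i) \<subseteq> edges G"
    and disj: "\<And>i j f. i \<in> J \<Longrightarrow> j \<in> J \<Longrightarrow> f \<in> tree_copies (\<psi> i) q T \<Longrightarrow> f \<in> tree_copies (\<psi> j) q T \<Longrightarrow>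
      i \<noteq> j \<Longrightarrow> matching_edges V f (g f i) \<inter> matching_edges V f (g f j) = {}"
  shows "\<exists>\<F>. edge_disjoint_factors T G \<F> \<and> (\<Union>F\<in>\<F>. factor_edges F) \<subseteq> edges G \<and>
    card (\<Union>F\<in>\<F>. factor_edges F) =
      m * (\<Sum>f\<in>{f. f \<subseteq> I \<and> card f = 2}. card {i\<in>J. f \<in> tree_copies (\<psi> i) q T})"
proof -
  define E where "E i = tree_copies (\<psi> i) q T" for i
  define K where "K = (\<lambda>(i, f). matching_edges V f (g f i))"
  have E: "f \<subseteq> I \<and> card f = 2" if "i \<in> J" "f \<in> E i" for i f
    using tree_copies_pairs[OF T \<psi>] that by (auto simp: E_def)
  have finE: "finite (E i)" for i using finite_tree_copies[OF T] by (simp add: E_def)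
  have m: "matching_on V f (g f i)" "matching_edges V f (g f i) \<subseteq> edges G" if "i \<in> J" "f \<in> E i" for i f
    using g that by (auto simp: E_def)
  have "\<exists>F. graph_factor T G F \<and> factor_edges F = (\<Union>f\<in>E i. K (i, f))" if "i \<in> J" for i
    unfolding E_def K_def prod.case
    by (rule tree_factor_of_matchings[OF T \<psi>[OF that] V G g[OF that]])
  then obtain Fac where Fac: "\<And>i. i \<in> J \<Longrightarrow> graph_factor T G (Fac i)"
    "\<And>i. i \<in> J \<Longrightarrow> factor_edges (Fac i) = (\<Union>f\<in>E i. K (i, f))" by metis
  have Kdisj: "K x \<inter> K y = {}" if xy: "x \<in> Sigma J E" "y \<in> Sigma J E" "x \<noteq> y" for x y
  proof -
    obtain i f j f' where x: "x = (i, f)" and y: "y = (j, f')" by (cases x, cases y)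
    have *: "i \<in> J" "f \<in> E i" "j \<in> J" "f' \<in> E j" using xy x y by auto
    show ?thesis
    proof (cases "f = f'")
      case True
      then show ?thesis using disj[of i j f] * xy x y by (auto simp: E_def K_def)
    next
      case False
      then show ?thesis
        using matching_edges_disjoint_classes[OF V(1) _ _ _ _ m(1)[OF *(1,2)] m(1)[OF *(3,4)]] E * x y
        by (auto simp: K_def)
    qed
  qed
  have Kcard: "card (K x) = m" if "x \<in> Sigma J E" for x
  proof -
    obtain i f where x: "x = (i, f)" by (cases x)
    have *: "i \<in> J" "f \<in> E i" using that x by auto
    obtain u v where uv: "f = {u, v}" "u \<noteq> v" using E[OF *] by (auto simp: card_2_iff)
    then have "u \<in> I" "v \<in> I" using E[OF *] by auto
    then have "V u \<inter> V v = {}" "card (V u) = m" using V uv by (auto simp: disjoint_family_on_def)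
    then show ?thesis using card_matching_edges[of V u v] m(1)[OF *] uv x by (simp add: K_def)
  qed
  have union: "(\<Union>F\<in>Fac ` J. factor_edges F) = (\<Union>x\<in>Sigma J E. K x)" using Fac(2) by force
  have "finite (K x)" if "x \<in> Sigma J E" for x
  proof -
    obtain i f where x: "x = (i, f)" by (cases x)
    have "f \<subseteq> I" "finite f" using that x E fin(2) by (auto intro: finite_subset)
    then show ?thesis using V(2) x by (auto simp: K_def matching_edges_def)
  qed
  then have "card (\<Union>x\<in>Sigma J E. K x) = (\<Sum>x\<in>Sigma J E. card (K x))"
    using Kdisj fin finE by (intro card_UN_disjoint) auto
  also have "\<dots> = m * card (Sigma J E)" using Kcard by simp
  \<comment> \<open>Incidences of factors and pairs are recounted by pair, because symmetrisation
    controls the number of factors on each pair.\<close>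
  also have "card (Sigma J E) = (\<Sum>f\<in>{f. f \<subseteq> I \<and> card f = 2}. card {i\<in>J. f \<in> E i})"
  proof -
    have "finite {f. f \<subseteq> I \<and> card f = 2}"
      using fin(2) by (intro finite_subset[OF _ finite_Pow_iff[THEN iffD2, OF fin(2)]]) auto
    then have "card (Sigma J E) = (\<Sum>f\<in>{f. f \<subseteq> I \<and> card f = 2}. card {i. (i, f) \<in> Sigma J E})"
      using fin finE E by (intro card_relation_eq_sum_snd[where A = J]) auto
    then show ?thesis by simp
  qed
  finally have "card (\<Union>F\<in>Fac ` J. factor_edges F) =
    m * (\<Sum>f\<in>{f. f \<subseteq> I \<and> card f = 2}. card {i\<in>J. f \<in> E i})" using union by simp
  moreover have "edge_disjoint_factors T G (Fac ` J)"
    unfolding edge_disjoint_factors_def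
  proof (intro conjI pairwise_imageI ballI)
    fix i j assume ij: "i \<in> J" "j \<in> J" "i \<noteq> j"
    have "K (i, f) \<inter> K (j, f') = {}" if "f \<in> E i" "f' \<in> E j" for f f'
      using ij that by (intro Kdisj) auto
    then show "disjnt (factor_edges (Fac i)) (factor_edges (Fac j))"
      using Fac(2) ij by (auto simp: disjnt_def)
  qed (use Fac in auto)
  moreover have "(\<Union>F\<in>Fac ` J. factor_edges F) \<subseteq> edges G"
    unfolding union using m(2) by (auto simp: K_def)
  ultimately show ?thesis unfolding E_def by blast
qed

section \<open>Symmetrisation over permutations of the classes\<close>

lemma exists_permutation_of_pairs:
  assumes "f \<subseteq> I" "card f = 2" "f' \<subseteq> I" "card f' = 2"
  shows "\<exists>\<pi>. \<pi> permutes I \<and> \<pi> ` f = f'"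
proof -
  obtain a b c d where f: "f = {a, b}" "a \<noteq> b" and f': "f' = {c, d}" "c \<noteq> d"
    using assms by (auto simp: card_2_iff)
  \<comment> \<open>The first transposition sends \<open>a\<close> to \<open>c\<close>; the second
    sends the current image of \<open>b\<close> to \<open>d\<close> and fixes \<open>c\<close>,
    which is neither that image nor \<open>d\<close>.\<close>
  define \<pi> where "\<pi> = Transposition.transpose (Transposition.transpose a c b) d \<circ> Transposition.transpose a c"
  have ac: "Transposition.transpose a c permutes I" using assms f f' by (intro permutes_swap_id) auto
  moreover have "Transposition.transpose a c b \<in> I"
    using permutes_in_image[OF ac, of b] assms f by auto
  then have "Transposition.transpose (Transposition.transpose a c b) d permutes I"
    using assms f' by (intro permutes_swap_id) auto
  ultimately have "\<pi> permutes I" unfolding \<pi>_def by (rule permutes_compose)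
  moreover have "\<pi> a = c" "\<pi> b = d" using f f' by (auto simp: \<pi>_def Transposition.transpose_def)
  ultimately show ?thesis using f f' by (intro exI[of _ \<pi>]) auto
qed

text \<open>If \<open>\<pi>\<close> maps \<open>f\<close> to \<open>f'\<close>, composition with
  \<open>\<pi>\<close> injects the permutations covering \<open>f\<close> into those covering
  \<open>f'\<close>; exchanging the roles gives equality.\<close>

lemma card_permutations_covering_pair:
  assumes "finite I" "f \<subseteq> I" "card f = 2" "f' \<subseteq> I" "card f' = 2"
  shows "card {\<sigma>. \<sigma> permutes I \<and> f \<in> (`) \<sigma> ` E} = card {\<sigma>. \<sigma> permutes I \<and> f' \<in> (`) \<sigma> ` E}"
proof -
  have le: "card {\<sigma>. \<sigma> permutes I \<and> f \<in> (`) \<sigma> ` E} \<le> card {\<sigma>. \<sigma> permutes I \<and> f' \<in> (`) \<sigma> ` E}"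
    if f: "f \<subseteq> I" "card f = 2" "f' \<subseteq> I" "card f' = 2" for f f'
  proof -
    obtain \<pi> where \<pi>: "\<pi> permutes I" "\<pi> ` f = f'" using exists_permutation_of_pairs[OF f] by blast
    show ?thesis
    proof (rule card_inj_on_le[of "\<lambda>\<sigma>. \<pi> \<circ> \<sigma>"])
      show "inj_on ((\<circ>) \<pi>) {\<sigma>. \<sigma> permutes I \<and> f \<in> (`) \<sigma> ` E}"
        using permutes_inj[OF \<pi>(1)] by (auto simp: inj_on_def fun.inj_map_strong inj_def fun_eq_iff)
      show "(\<circ>) \<pi> ` {\<sigma>. \<sigma> permutes I \<and> f \<in> (`) \<sigma> ` E} \<subseteq> {\<sigma>. \<sigma> permutes I \<and> f' \<in> (`) \<sigma> ` E}"
        using \<pi> by (auto intro!: permutes_compose simp: image_comp image_image)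
      show "finite {\<sigma>. \<sigma> permutes I \<and> f' \<in> (`) \<sigma> ` E}"
        using finite_permutations[OF assms(1)] by (rule rev_finite_subset) auto
    qed
  qed
  show ?thesis using le[OF assms(2-5)] le[OF assms(4,5,2,3)] by simp
qed

lemma tree_copies_comp: "tree_copies (\<sigma> \<circ> \<psi>) q T = (`) \<sigma> ` tree_copies \<psi> q T"
  by (simp add: tree_copies_def image_UN image_image comp_def)

section \<open>From sets of unordered edges to matchings between two classes\<close>

definition cross :: "'v set \<Rightarrow> 'v set \<Rightarrow> 'v set set" where
  "cross S W = (\<lambda>(a, b). {a, b}) ` (S \<times> W)"

lemma inj_on_cross: "S \<inter> W = {} \<Longrightarrow> inj_on (\<lambda>(a, b). {a, b}) (S \<times> W)"
  by (auto simp: inj_on_def doubleton_eq_iff)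

lemma card_cross: "S \<inter> W = {} \<Longrightarrow> card (cross S W) = card S * card W"
  by (simp add: cross_def card_image inj_on_cross card_cartesian_product)

lemma matching_onI:
  assumes "\<And>a. a \<in> V x \<Longrightarrow> g a \<in> V y \<and> g (g a) = a" "\<And>a. a \<in> V y \<Longrightarrow> g a \<in> V x \<and> g (g a) = a"
  shows "matching_on V {x, y} g"
  unfolding matching_on_def
proof (intro allI impI ballI)
  fix x' y' a assume "{x, y} = {x', y'}" "a \<in> V x'"
  then consider "x' = x" "y' = y" | "x' = y" "y' = x" by (auto simp: doubleton_eq_iff)
  then show "g a \<in> V y' \<and> g (g a) = a" using assms \<open>a \<in> V x'\<close> by cases simp_all
qed

text \<open>Restates Ore's condition for the relation between \<open>V x\<close> and
  \<open>V y\<close>, splits the regular subgraph it yields into matchings, and turns each matching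
  into an involution.\<close>

lemma matchings_between_classes:
  assumes fin: "finite (V x)" "finite (V y)" and m: "card (V x) = m" "card (V y) = m"
    and disj: "V x \<inter> V y = {}" and "finite I"
    and ore: "\<And>S W. S \<subseteq> V x \<Longrightarrow> W \<subseteq> V y \<Longrightarrow>
      card I * (card S + card W) \<le> card (D \<inter> cross S W) + card I * m"
  shows "\<exists>g. (\<forall>i\<in>I. matching_on V {x, y} (g i) \<and> matching_edges V {x, y} (g i) \<subseteq> D) \<and>
    (\<forall>i\<in>I. \<forall>j\<in>I. i \<noteq> j \<longrightarrow> matching_edges V {x, y} (g i) \<inter> matching_edges V {x, y} (g j) = {})"
proof -
  define E where "E = {(a, b) \<in> V x \<times> V y. {a, b} \<in> D}"
  have "card (E \<inter> S \<times> W) = card (D \<inter> cross S W)" if "S \<subseteq> V x" "W \<subseteq> V y" for S W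
  proof -
    have "D \<inter> cross S W = (\<lambda>(a, b). {a, b}) ` (E \<inter> S \<times> W)"
    proof (intro equalityI subsetI)
      fix e assume "e \<in> D \<inter> cross S W"
      then obtain a b where "e = {a, b}" "a \<in> S" "b \<in> W" "e \<in> D" by (auto simp: cross_def)
      then show "e \<in> (\<lambda>(a, b). {a, b}) ` (E \<inter> S \<times> W)"
        using that by (intro image_eqI[of _ _ "(a, b)"]) (auto simp: E_def)
    next
      fix e assume "e \<in> (\<lambda>(a, b). {a, b}) ` (E \<inter> S \<times> W)"
      then show "e \<in> D \<inter> cross S W" by (auto simp: cross_def E_def)
    qed
    moreover have "S \<inter> W = {}" using that disj by blast
    then have "inj_on (\<lambda>(a, b). {a, b}) (E \<inter> S \<times> W)"
      by (rule inj_on_subset[OF inj_on_cross]) auto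
    ultimately show ?thesis by (simp add: card_image)
  qed
  then have "\<exists>H\<subseteq>E. (\<forall>a\<in>V x. card {b. (a, b) \<in> H} = card I) \<and> (\<forall>b\<in>V y. card {a. (a, b) \<in> H} = card I)"
    using ore by (intro bipartite_regular_spanning_subgraph[OF fin m]) (auto simp: E_def)
  then obtain H where H: "H \<subseteq> E" "\<And>a. a \<in> V x \<Longrightarrow> card {b. (a, b) \<in> H} = card I"
    "\<And>b. b \<in> V y \<Longrightarrow> card {a. (a, b) \<in> H} = card I" by blast
  have "H \<subseteq> V x \<times> V y" using H(1) by (auto simp: E_def)
  from regular_bipartite_matching_decomposition[OF \<open>finite I\<close> fin _ this H(2,3)] m
  obtain f where f: "\<And>i. i \<in> I \<Longrightarrow> bij_betw (f i) (V x) (V y)"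
    "\<And>i a. i \<in> I \<Longrightarrow> a \<in> V x \<Longrightarrow> (a, f i a) \<in> H"
    "\<And>i j a. i \<in> I \<Longrightarrow> j \<in> I \<Longrightarrow> i \<noteq> j \<Longrightarrow> a \<in> V x \<Longrightarrow> f i a \<noteq> f j a" by metis
  \<comment> \<open>The bijection on \<open>V x\<close> and its inverse on \<open>V y\<close>; since
    the classes are disjoint, this is one well-defined involution on their union.\<close>
  define g where "g i a = (if a \<in> V x then f i a else inv_into (V x) (f i) a)" for i a
  have gx: "g i a = f i a" "f i a \<in> V y" if "i \<in> I" "a \<in> V x" for i a
    using f(1)[OF that(1)] that by (auto simp: g_def bij_betw_def)
  have "g i a \<in> V y \<and> g i (g i a) = a" if "i \<in> I" "a \<in> V x" for i a
  proof -
    have "f i a \<notin> V x" using gx[OF that] disj by blast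
    then show ?thesis
      using gx[OF that] bij_betw_inv_into_left[OF f(1)[OF that(1)] that(2)] that by (simp add: g_def)
  qed
  moreover have "g i a \<in> V x \<and> g i (g i a) = a" if "i \<in> I" "a \<in> V y" for i a
  proof -
    have "a \<notin> V x" using that disj by blast
    moreover have "inv_into (V x) (f i) a \<in> V x"
      using bij_betw_inv_into[OF f(1)[OF that(1)]] that(2) by (auto simp: bij_betw_def)
    ultimately show ?thesis
      using bij_betw_inv_into_right[OF f(1)[OF that(1)] that(2)] by (simp add: g_def)
  qed
  ultimately have match: "matching_on V {x, y} (g i)" if "i \<in> I" for i
    using that by (intro matching_onI) auto
  have edges: "matching_edges V {x, y} (g i) = (\<lambda>a. {a, f i a}) ` V x" if "i \<in> I" for i
    using matching_edges_eq[OF match[OF that]] gx[OF that] by simp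
  show ?thesis
  proof (intro exI[of _ g] conjI ballI impI)
    fix i assume i: "i \<in> I"
    show "matching_edges V {x, y} (g i) \<subseteq> D"
      unfolding edges[OF i] using f(2)[OF i] H(1) by (auto simp: E_def)
    show "matching_on V {x, y} (g i)" by (rule match[OF i])
    fix j assume j: "j \<in> I" "i \<noteq> j"
    show "matching_edges V {x, y} (g i) \<inter> matching_edges V {x, y} (g j) = {}"
    proof (rule ccontr)
      assume "matching_edges V {x, y} (g i) \<inter> matching_edges V {x, y} (g j) \<noteq> {}"
      then obtain a b where ab: "a \<in> V x" "b \<in> V x" "{a, f i a} = {b, f j b}"
        unfolding edges[OF i] edges[OF j(1)] by blast
      have "a \<noteq> f j b" using gx(2)[OF j(1) ab(2)] ab(1) disj by blast
      then have "a = b" "f i a = f j b" using ab(3) by (auto simp: doubleton_eq_iff)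
      then show False using f(3)[OF i j(1) j(2) ab(1)] by simp
    qed
  qed
qed

text \<open>Averaging a fixed \<open>T\<close>-factor of the complete graph on the classes over all permutations covers
  every pair of classes equally often, namely \<open>N\<close> times.\<close>

lemma tree_packing_of_ore:
  fixes T :: "'a ugraph"
  assumes T: "is_tree T" "card (verts T) \<ge> 2" and \<tau>: "card (verts T) dvd \<tau>" "\<tau> > 0"
  shows "\<exists>N>0. \<forall>(G :: 'v ugraph) V m L. disjoint_family_on V {..<\<tau>} \<longrightarrow>
    (\<forall>x<\<tau>. finite (V x) \<and> card (V x) = m) \<longrightarrow> verts G = (\<Union>x<\<tau>. V x) \<longrightarrow>
    (\<forall>x<\<tau>. \<forall>y<\<tau>. x \<noteq> y \<longrightarrow> (\<forall>S\<subseteq>V x. \<forall>W\<subseteq>V y.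
       N * L * (card S + card W) \<le> card (edges G \<inter> cross S W) + N * L * m)) \<longrightarrow>
    (\<exists>\<F>. edge_disjoint_factors T G \<F> \<and> (\<Union>F\<in>\<F>. factor_edges F) \<subseteq> edges G \<and>
      card (\<Union>F\<in>\<F>. factor_edges F) = m * ((\<tau> choose 2) * (N * L)))"
proof -
  define q where "q = \<tau> div card (verts T)"
  have finT: "finite (verts T)" using T by (auto simp: is_tree_def simple_graph_def)
  have q: "\<tau> = q * card (verts T)" "q > 0" using \<tau> by (auto simp: q_def)
  then have "card ({..<q} \<times> verts T) = card {..<\<tau>}" by (simp add: card_cartesian_product)
  then obtain \<psi> where \<psi>: "bij_betw \<psi> ({..<q} \<times> verts T) {..<\<tau>}"
    using finite_same_card_bij[of "{..<q} \<times> verts T" "{..<\<tau>}"] finT by auto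
  define E where "E = tree_copies \<psi> q T"
  \<comment> \<open>An edge of \<open>T\<close> provides a pair \<open>f0\<close> used by the fixed
    factor. Then \<open>id\<close> covers \<open>f0\<close>, and so \<open>N > 0\<close>.\<close>
  have "edges T \<noteq> {}"
  proof -
    obtain u v where uv: "u \<in> verts T" "v \<in> verts T" "u \<noteq> v"
      using T(2) finT by (metis card_2_iff' obtain_subset_with_card_n subset_iff)
    then have "(adj T)\<^sup>*\<^sup>* u v" using T by (auto simp: is_tree_def graph_connected_def)
    then obtain w where "adj T u w" using uv(3) by (meson converse_rtranclpE)
    then show ?thesis by (auto simp: adj_def)
  qed
  then obtain f0 where f0: "f0 \<in> E" using q by (auto simp: E_def tree_copies_def)
  have f0': "f0 \<subseteq> {..<\<tau>} \<and> card f0 = 2"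
    using tree_copies_pairs[OF T(1) \<psi>] f0 by (auto simp: E_def)
  define cov where "cov f = {\<sigma>. \<sigma> permutes {..<\<tau>} \<and> f \<in> (`) \<sigma> ` E}" for f
  \<comment> \<open>\<open>N\<close> is fixed before \<open>G\<close>, \<open>m\<close> and
    \<open>L\<close>: it depends only on \<open>T\<close>, \<open>\<tau>\<close> and the chosen
    \<open>\<psi>\<close>.\<close>
  define N where "N = card (cov f0)"
  have finperm: "finite {\<sigma>. \<sigma> permutes {..<\<tau>}}" by (intro finite_permutations) auto
  have fincov: "finite (cov f)" for f by (rule finite_subset[OF _ finperm]) (auto simp: cov_def)
  have "id \<in> cov f0" using f0 by (auto simp: cov_def permutes_id image_iff)
  then have "N > 0" using fincov by (auto simp: N_def card_gt_0_iff)
  have N: "card (cov f) = N" if "f \<subseteq> {..<\<tau>}" "card f = 2" for f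
    unfolding N_def cov_def using f0' that by (intro card_permutations_covering_pair) auto
  show ?thesis
  proof (intro exI[of _ N] conjI allI impI)
    fix G :: "'v ugraph" and V m L
    assume V: "disjoint_family_on V {..<\<tau>}" "\<forall>x<\<tau>. finite (V x) \<and> card (V x) = m"
      and G: "verts G = (\<Union>x<\<tau>. V x)"
      and ore: "\<forall>x<\<tau>. \<forall>y<\<tau>. x \<noteq> y \<longrightarrow> (\<forall>S\<subseteq>V x. \<forall>W\<subseteq>V y.
       N * L * (card S + card W) \<le> card (edges G \<inter> cross S W) + N * L * m)"
    \<comment> \<open>Every permutation is used \<open>L\<close> times, so each pair of classes lies
      in \<open>N * L\<close> factors; this is the degree demanded from the bipartite
      graphs.\<close>
    define J where "J = {\<sigma>. \<sigma> permutes {..<\<tau>}} \<times> {..<L}"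
    define \<Psi> where "\<Psi> i = fst i \<circ> \<psi>" for i :: "(nat \<Rightarrow> nat) \<times> nat"
    have finJ: "finite J" using finperm by (simp add: J_def)
    have \<Psi>: "bij_betw (\<Psi> i) ({..<q} \<times> verts T) {..<\<tau>}" if "i \<in> J" for i
      unfolding \<Psi>_def using that
      by (intro bij_betw_trans[OF \<psi>]) (auto simp: J_def intro: permutes_imp_bij)
    \<comment> \<open>The factors using the pair \<open>f\<close>. Indexing the matchings on
      \<open>f\<close> by this set hands each of these factors a matching of its own.\<close>
    define I where "I f = {i\<in>J. f \<in> tree_copies (\<Psi> i) q T}" for f
    have "I f = cov f \<times> {..<L}" for f
      by (auto simp: I_def J_def \<Psi>_def cov_def E_def tree_copies_comp)
    then have cI: "card (I f) = N * L" if "f \<subseteq> {..<\<tau>}" "card f = 2" for f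
      using N[OF that] by (simp add: card_cartesian_product)
    have finI: "finite (I f)" for f using finJ by (simp add: I_def)
    have "\<exists>g. (\<forall>i\<in>I f. matching_on V f (g i) \<and> matching_edges V f (g i) \<subseteq> edges G) \<and>
      (\<forall>i\<in>I f. \<forall>j\<in>I f. i \<noteq> j \<longrightarrow> matching_edges V f (g i) \<inter> matching_edges V f (g j) = {})"
      if f: "f \<subseteq> {..<\<tau>}" "card f = 2" for f
    proof -
      obtain x y where xy: "f = {x, y}" "x \<noteq> y" using f(2) by (auto simp: card_2_iff)
      then have lt: "x < \<tau>" "y < \<tau>" using f(1) by auto
      have disj: "V x \<inter> V y = {}" using V(1) lt xy(2) by (auto simp: disjoint_family_on_def)
      show ?thesis unfolding xy(1)
      proof (rule matchings_between_classes[where m = m])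
        show "finite (V x)" "finite (V y)" "card (V x) = m" "card (V y) = m" using V(2) lt by auto
        fix S W assume "S \<subseteq> V x" "W \<subseteq> V y"
        then show "card (I {x, y}) * (card S + card W)
            \<le> card (edges G \<inter> cross S W) + card (I {x, y}) * m"
          using ore lt xy cI[OF f] by auto
      qed (use disj finI in auto)
    qed
    then obtain g where g: "\<And>f i. \<lbrakk>f \<subseteq> {..<\<tau>}; card f = 2; i \<in> I f\<rbrakk> \<Longrightarrow>
        matching_on V f (g f i) \<and> matching_edges V f (g f i) \<subseteq> edges G"
      "\<And>f i j. \<lbrakk>f \<subseteq> {..<\<tau>}; card f = 2; i \<in> I f; j \<in> I f; i \<noteq> j\<rbrakk> \<Longrightarrow>
        matching_edges V f (g f i) \<inter> matching_edges V f (g f j) = {}" by metis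
    have pairs: "f \<subseteq> {..<\<tau>} \<and> card f = 2 \<and> i \<in> I f" if "i \<in> J" "f \<in> tree_copies (\<Psi> i) q T" for i f
      using tree_copies_pairs[OF T(1) \<Psi>[OF that(1)] that(2)] that by (simp add: I_def)
    have "\<exists>\<F>. edge_disjoint_factors T G \<F> \<and> (\<Union>F\<in>\<F>. factor_edges F) \<subseteq> edges G \<and>
      card (\<Union>F\<in>\<F>. factor_edges F) =
        m * (\<Sum>f\<in>{f. f \<subseteq> {..<\<tau>} \<and> card f = 2}. card {i\<in>J. f \<in> tree_copies (\<Psi> i) q T})"
    proof (rule tree_factors_of_matchings[OF T(1) finJ _ \<Psi> V(1) _ G])
      fix i f assume "i \<in> J" "f \<in> tree_copies (\<Psi> i) q T"
      then show "matching_on V f (g f i) \<and> matching_edges V f (g f i) \<subseteq> edges G"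
        using pairs g(1) by blast
    next
      fix i j f assume "i \<in> J" "j \<in> J" "f \<in> tree_copies (\<Psi> i) q T" "f \<in> tree_copies (\<Psi> j) q T" "i \<noteq> j"
      then show "matching_edges V f (g f i) \<inter> matching_edges V f (g f j) = {}"
        using pairs g(2) by blast
    qed (use V(2) in auto)
    moreover have "(\<Sum>f\<in>{f. f \<subseteq> {..<\<tau>} \<and> card f = 2}. card (I f)) = (\<tau> choose 2) * (N * L)"
      using cI by (simp add: n_subsets)
    ultimately show "\<exists>\<F>. edge_disjoint_factors T G \<F> \<and> (\<Union>F\<in>\<F>. factor_edges F) \<subseteq> edges G \<and>
      card (\<Union>F\<in>\<F>. factor_edges F) = m * ((\<tau> choose 2) * (N * L))"
      unfolding I_def by simp
  qed (use \<open>N > 0\<close> in auto)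
qed

section \<open>Binomial tail bounds\<close>

text \<open>Holding for both signs of \<open>s\<close>, this lets one Chernoff bound serve both
  tails. For negative \<open>s\<close> it follows from
  \<open>(1 - s) * (1 + s + s\<^sup>2) = 1 - s ^ 3 \<ge> 1\<close> and
  \<open>exp (- s) \<ge> 1 - s\<close>.\<close>

lemma exp_le_quadratic:
  fixes s :: real
  assumes "\<bar>s\<bar> \<le> 1"
  shows "exp s \<le> 1 + s + s\<^sup>2"
proof (cases "s \<ge> 0")
  case True
  then show ?thesis using exp_bound assms by auto
next
  case False
  have "(1 - s) * (1 + s + s\<^sup>2) = 1 - s ^ 3" by (simp add: algebra_simps power2_eq_square power3_eq_cube)
  moreover have "s ^ 3 \<le> 0" using False by (simp add: power3_eq_cube mult_nonneg_nonpos zero_le_mult_iff mult_le_0_iff)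
  ultimately have "1 \<le> (1 - s) * (1 + s + s\<^sup>2)" by simp
  moreover have "exp (- s) \<ge> 1 - s" using exp_ge_add_one_self[of "-s"] by simp
  moreover have "1 + s + s\<^sup>2 \<ge> 0" using assms by (auto intro: add_nonneg_nonneg)
  ultimately have "1 \<le> exp (- s) * (1 + s + s\<^sup>2)" by (meson mult_right_mono order_trans)
  then show ?thesis by (simp add: exp_minus field_simps)
qed

abbreviation coins :: "'e set \<Rightarrow> real \<Rightarrow> ('e \<Rightarrow> bool) pmf" where
  "coins U p \<equiv> Pi_pmf U False (\<lambda>_. bernoulli_pmf p)"

text \<open>By independence each coin of \<open>E\<close> contributes the factor
  \<open>1 + p * (exp s - 1)\<close>, coins of \<open>U - E\<close> contribute 1, and
  \<open>1 + y \<le> exp y\<close> merges the factors.\<close>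

lemma coins_mgf_le:
  fixes p s :: real
  assumes U: "finite U" "E \<subseteq> U" and p: "0 \<le> p" "p \<le> 1"
  shows "measure_pmf.expectation (coins U p) (\<lambda>b. exp (s * real (card {e\<in>E. b e})))
      \<le> exp (p * real (card E) * (exp s - 1))"
    and "integrable (coins U p) (\<lambda>b. exp (s * real (card {e\<in>E. b e})))"
proof -
  define f where "f e v = (if e \<in> E \<and> v then exp s else 1)" for e v
  have finE: "finite E" using U finite_subset by blast
  have eq: "exp (s * real (card {e\<in>E. b e})) = (\<Prod>e\<in>U. f e (b e))" for b
  proof -
    have "(\<Prod>e\<in>U. f e (b e)) = (\<Prod>e\<in>U. if e \<in> {e\<in>E. b e} then exp s else 1)"
      by (intro prod.cong) (auto simp: f_def)
    also have "\<dots> = (\<Prod>e\<in>{e\<in>E. b e}. exp s)"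
    proof -
      have "U \<inter> {e\<in>E. b e} = {e\<in>E. b e}" using U by auto
      then show ?thesis using prod.inter_restrict[OF U(1), of "\<lambda>_. exp s" "{e\<in>E. b e}"] by simp
    qed
    also have "\<dots> = exp (s * real (card {e\<in>E. b e}))" by (simp add: exp_of_nat2_mult)
    finally show ?thesis by simp
  qed
  show "integrable (coins U p) (\<lambda>b. exp (s * real (card {e\<in>E. b e})))"
    unfolding eq by (rule integrable_prod_Pi_pmf) (use U in \<open>auto intro: integrable_measure_pmf_finite\<close>)
  have "measure_pmf.expectation (coins U p) (\<lambda>b. \<Prod>e\<in>U. f e (b e)) =
    (\<Prod>e\<in>U. measure_pmf.expectation (bernoulli_pmf p) (f e))"
    by (rule expectation_prod_Pi_pmf) (use U in \<open>auto simp: f_def intro: integrable_measure_pmf_finite\<close>)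
  also have "\<dots> = (\<Prod>e\<in>U. if e \<in> E then 1 + p * (exp s - 1) else 1)"
    using p by (intro prod.cong) (auto simp: f_def algebra_simps)
  also have "\<dots> = (1 + p * (exp s - 1)) ^ card E"
    using U by (subst prod.inter_restrict[symmetric]) (auto simp: Int_absorb1)
  also have "\<dots> \<le> exp (p * (exp s - 1)) ^ card E"
  proof (rule power_mono)
    have "p * exp s \<ge> 0" using p by simp
    then show "0 \<le> 1 + p * (exp s - 1)" using p unfolding right_diff_distrib by linarith
  qed (rule exp_ge_add_one_self)
  also have "\<dots> = exp (p * real (card E) * (exp s - 1))"
    by (simp add: exp_of_nat_mult[symmetric] mult_ac)
  finally show "measure_pmf.expectation (coins U p) (\<lambda>b. exp (s * real (card {e\<in>E. b e})))
      \<le> exp (p * real (card E) * (exp s - 1))" unfolding eq .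
qed

text \<open>The sign of \<open>s\<close> selects the tail. Deviation \<open>2 * s\<close> fits the
  quadratic bound: \<open>s + s\<^sup>2 - s * (1 + 2 * s) = - s\<^sup>2\<close>. Relative deviation
  \<open>\<delta>\<close> thus means \<open>s = \<delta> / 2\<close> or
  \<open>s = - \<delta> / 2\<close>, whence the 4 in the tail bounds.\<close>

lemma coins_chernoff:
  fixes p s :: real
  assumes U: "finite U" "E \<subseteq> U" and p: "0 \<le> p" "p \<le> 1" and s: "\<bar>s\<bar> \<le> 1"
  shows "measure_pmf.prob (coins U p) {b. s * real (card {e\<in>E. b e}) \<ge> s * ((1 + 2 * s) * p * real (card E))}
    \<le> exp (- (p * real (card E) * s\<^sup>2))"
proof -
  let ?c = "s * ((1 + 2 * s) * p * real (card E))"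
  let ?X = "\<lambda>b. exp (s * real (card {e\<in>E. b e}))"
  have "{b. s * real (card {e\<in>E. b e}) \<ge> ?c} = {b\<in>space (coins U p). ?X b \<ge> exp ?c}" by simp
  then have "measure_pmf.prob (coins U p) {b. s * real (card {e\<in>E. b e}) \<ge> ?c}
      \<le> measure_pmf.expectation (coins U p) ?X / exp ?c"
    using integral_Markov_inequality_measure[OF coins_mgf_le(2)[OF U p, of s], of "{}" "exp ?c"] by simp
  also have "\<dots> \<le> exp (p * real (card E) * (exp s - 1)) / exp ?c"
    by (intro divide_right_mono coins_mgf_le(1)[OF U p]) auto
  also have "\<dots> = exp (p * real (card E) * (exp s - 1) - ?c)" by (simp add: exp_diff)
  also have "p * real (card E) * (exp s - 1) - ?c \<le> p * real (card E) * (s + s\<^sup>2) - ?c"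
    using exp_le_quadratic[OF s] p by (intro diff_right_mono mult_left_mono) auto
  also have "\<dots> = - (p * real (card E) * s\<^sup>2)" by (simp add: algebra_simps power2_eq_square)
  finally show ?thesis by simp
qed

lemma coins_lower_tail:
  fixes p \<delta> :: real
  assumes U: "finite U" "E \<subseteq> U" and p: "0 \<le> p" "p \<le> 1" and \<delta>: "0 < \<delta>" "\<delta> \<le> 1"
  shows "measure_pmf.prob (coins U p) {b. real (card {e\<in>E. b e}) < (1 - \<delta>) * p * real (card E)}
    \<le> exp (- (p * real (card E) * \<delta>\<^sup>2 / 4))"
proof -
  have "measure_pmf.prob (coins U p) {b. real (card {e\<in>E. b e}) < (1 - \<delta>) * p * real (card E)} \<le>
    measure_pmf.prob (coins U p)
      {b. (-\<delta>/2) * real (card {e\<in>E. b e}) \<ge> (-\<delta>/2) * ((1 + 2 * (-\<delta>/2)) * p * real (card E))}"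
    using \<delta> by (intro measure_pmf.finite_measure_mono) auto
  also have "\<dots> \<le> exp (- (p * real (card E) * (-\<delta>/2)\<^sup>2))"
    by (rule coins_chernoff) (use assms in auto)
  finally show ?thesis by (simp add: power_divide)
qed

lemma coins_upper_tail:
  fixes p \<delta> :: real
  assumes U: "finite U" "E \<subseteq> U" and p: "0 \<le> p" "p \<le> 1" and \<delta>: "0 < \<delta>" "\<delta> \<le> 1"
  shows "measure_pmf.prob (coins U p) {b. real (card {e\<in>E. b e}) > (1 + \<delta>) * p * real (card E)}
    \<le> exp (- (p * real (card E) * \<delta>\<^sup>2 / 4))"
proof -
  have "measure_pmf.prob (coins U p) {b. real (card {e\<in>E. b e}) > (1 + \<delta>) * p * real (card E)} \<le>
    measure_pmf.prob (coins U p)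
      {b. (\<delta>/2) * real (card {e\<in>E. b e}) \<ge> (\<delta>/2) * ((1 + 2 * (\<delta>/2)) * p * real (card E))}"
    using \<delta> by (intro measure_pmf.finite_measure_mono) auto
  also have "\<dots> \<le> exp (- (p * real (card E) * (\<delta>/2)\<^sup>2))"
    by (rule coins_chernoff) (use assms in auto)
  finally show ?thesis by (simp add: power_divide)
qed

text \<open>Binomial theorem over subsets, for a union bound in which sets are weighted by their
  size or by the size of their complement.\<close>

lemma sum_power_card_Pow:
  fixes x :: "'b :: comm_semiring_1"
  assumes "finite A"
  shows "(\<Sum>S\<in>Pow A. x ^ card S) = (1 + x) ^ card A"
    and "(\<Sum>S\<in>Pow A. x ^ (card A - card S)) = (1 + x) ^ card A"
proof -
  have "(\<Prod>a\<in>A. x + 1) = (\<Sum>S\<in>Pow A. (\<Prod>a\<in>S. x) * (\<Prod>a\<in>A - S. 1))"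
    by (rule prod_add[OF assms])
  then show "(\<Sum>S\<in>Pow A. x ^ card S) = (1 + x) ^ card A" by (simp add: add.commute)
  have "(\<Prod>a\<in>A. 1 + x) = (\<Sum>S\<in>Pow A. (\<Prod>a\<in>S. 1) * (\<Prod>a\<in>A - S. x))"
    by (rule prod_add[OF assms])
  also have "\<dots> = (\<Sum>S\<in>Pow A. x ^ (card A - card S))"
    using assms by (intro sum.cong) (auto simp: card_Diff_subset finite_subset)
  finally show "(\<Sum>S\<in>Pow A. x ^ (card A - card S)) = (1 + x) ^ card A" by simp
qed

text \<open>With \<open>card S \<le> card W\<close> and \<open>card S + card W > m\<close>, the number of choices of \<open>S\<close> and of the
  complement of \<open>W\<close> is governed by \<open>card S\<close>, while \<open>cross S W\<close> has at least \<open>m * card S / 2\<close> pairs.\<close>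

lemma coins_cross_lower_tail:
  fixes p \<delta> x :: real and A B :: "'a set"
  assumes U: "finite U" "cross A B \<subseteq> U" and p: "0 \<le> p" "p \<le> 1" and \<delta>: "0 < \<delta>" "\<delta> \<le> 1"
    and A: "finite A" "card A = m" and B: "finite B" "card B = m" and AB: "A \<inter> B = {}"
    and x: "0 \<le> x" "x \<le> 1" "exp (- (p * real m * \<delta>\<^sup>2 / 8)) \<le> x\<^sup>2"
  shows "measure_pmf.prob (coins U p) {b. \<exists>S\<subseteq>A. \<exists>W\<subseteq>B. m < card S + card W \<and>
      real (card {e\<in>cross S W. b e}) < (1 - \<delta>) * p * real (card S * card W)}
    \<le> 2 * (((1 + x) ^ m - 1) * (1 + x) ^ m)"
proof -
  define Q where "Q = {(S, W). S \<subseteq> A \<and> W \<subseteq> B \<and> m < card S + card W}"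
  define bad :: "'a set \<times> 'a set \<Rightarrow> ('a set \<Rightarrow> bool) set" where "bad = (\<lambda>(S, W). {b. real (card {e\<in>cross S W. b e}) < (1 - \<delta>) * p * real (card (cross S W))})"
  have finQ: "finite Q"
    by (rule finite_subset[of _ "Pow A \<times> Pow B"]) (use A B in \<open>auto simp: Q_def\<close>)
  have card_le: "card S \<le> m" "card W \<le> m" if "(S, W) \<in> Q" for S W
    using that A B card_mono[of A S] card_mono[of B W] by (auto simp: Q_def)
  have cc: "card (cross S W) = card S * card W" if "(S, W) \<in> Q" for S W
  proof -
    have "S \<inter> W = {}" using that AB by (auto simp: Q_def)
    then show ?thesis by (rule card_cross)
  qed
  \<comment> \<open>Here \<open>w > m / 2\<close>, so \<open>s * w \<ge> s * m / 2\<close>, and the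
    hypothesis on \<open>x\<close> gives the bound \<open>x ^ (2 * s)\<close>.\<close>
  have main: "exp (- (p * real (s * w) * \<delta>\<^sup>2 / 4)) \<le> x ^ s * x ^ (m - w)"
    if "s \<le> w" "m < s + w" for s w :: nat
  proof -
    have "real s * (m / 2) \<le> real s * w" using that by (intro mult_left_mono) auto
    then have "(p * \<delta>\<^sup>2 / 4) * (real s * (m / 2)) \<le> (p * \<delta>\<^sup>2 / 4) * (real s * w)"
      by (rule mult_left_mono) (use p in auto)
    then have "exp (- (p * real (s * w) * \<delta>\<^sup>2 / 4)) \<le> exp (real s * (- (p * real m * \<delta>\<^sup>2 / 8)))"
    proof -
      assume "p * \<delta>\<^sup>2 / 4 * (real s * (real m / 2)) \<le> p * \<delta>\<^sup>2 / 4 * (real s * real w)"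
      moreover have "p * \<delta>\<^sup>2 / 4 * (real s * (real m / 2)) = - (real s * (- (p * real m * \<delta>\<^sup>2 / 8)))"
        "p * \<delta>\<^sup>2 / 4 * (real s * real w) = p * real (s * w) * \<delta>\<^sup>2 / 4" by simp_all
      ultimately show ?thesis unfolding exp_le_cancel_iff by linarith
    qed
    also have "\<dots> = exp (- (p * real m * \<delta>\<^sup>2 / 8)) ^ s" by (rule exp_of_nat_mult)
    also have "\<dots> \<le> (x\<^sup>2) ^ s" using x by (intro power_mono) auto
    also have "\<dots> = x ^ (2 * s)" by (simp add: power_mult)
    \<comment> \<open>As \<open>m - w < s\<close>, one half of the exponent pays for the choice of
      \<open>S\<close> and the other for the complement of \<open>W\<close>.\<close>
    also have "\<dots> \<le> x ^ (s + (m - w))" using x that by (intro power_decreasing) auto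
    finally show ?thesis by (simp add: power_add)
  qed
  have nn: "0 \<le> x ^ i * x ^ j" for i j using x by simp
  \<comment> \<open>The two summands cover the two cases for which of \<open>S\<close> and
    \<open>W\<close> is the smaller set.\<close>
  have bad_le: "measure_pmf.prob (coins U p) (bad (S, W)) \<le>
      x ^ card S * x ^ (m - card W) + x ^ (m - card S) * x ^ card W" if SW: "(S, W) \<in> Q" for S W
  proof -
    have "cross S W \<subseteq> U" using SW U by (fastforce simp: Q_def cross_def)
    then have "measure_pmf.prob (coins U p) (bad (S, W)) \<le> exp (- (p * real (card (cross S W)) * \<delta>\<^sup>2 / 4))"
      unfolding bad_def prod.case using U p \<delta> by (intro coins_lower_tail) auto
    also have "\<dots> = exp (- (p * real (card S * card W) * \<delta>\<^sup>2 / 4))" using cc[OF SW] by simp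
    also have "\<dots> \<le> x ^ card S * x ^ (m - card W) + x ^ (m - card S) * x ^ card W"
    proof (cases "card S \<le> card W")
      case True
      then show ?thesis using main[of "card S" "card W"] SW nn[of "m - card S" "card W"]
        by (simp add: Q_def)
    next
      case False
      then show ?thesis using main[of "card W" "card S"] SW nn[of "card S" "m - card W"]
        by (simp add: Q_def ac_simps)
    qed
    finally show ?thesis .
  qed
  have sums: "(\<Sum>S\<in>Pow A - {{}}. x ^ card S) = (1 + x) ^ m - 1" "(\<Sum>S\<in>Pow B - {{}}. x ^ card S) = (1 + x) ^ m - 1"
    "(\<Sum>S\<in>Pow A. x ^ (m - card S)) = (1 + x) ^ m" "(\<Sum>S\<in>Pow B. x ^ (m - card S)) = (1 + x) ^ m"
    using sum_power_card_Pow[OF A(1), of x] sum_power_card_Pow[OF B(1), of x] A B by (simp_all add: sum_diff1)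
  have "measure_pmf.prob (coins U p) {b. \<exists>S\<subseteq>A. \<exists>W\<subseteq>B. m < card S + card W \<and>
      real (card {e\<in>cross S W. b e}) < (1 - \<delta>) * p * real (card S * card W)} \<le>
    measure_pmf.prob (coins U p) (\<Union>SW\<in>Q. bad SW)"
  proof (rule measure_pmf.finite_measure_mono)
    show "{b. \<exists>S\<subseteq>A. \<exists>W\<subseteq>B. m < card S + card W \<and>
      real (card {e\<in>cross S W. b e}) < (1 - \<delta>) * p * real (card S * card W)} \<subseteq> (\<Union>SW\<in>Q. bad SW)"
    proof clarify
      fix b S W assume *: "S \<subseteq> A" "W \<subseteq> B" "m < card S + card W"
        "real (card {e\<in>cross S W. b e}) < (1 - \<delta>) * p * real (card S * card W)"
      then have SW: "(S, W) \<in> Q" by (simp add: Q_def)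
      then have "b \<in> bad (S, W)" using *(4) cc[OF SW] by (simp add: bad_def)
      then show "b \<in> (\<Union>SW\<in>Q. bad SW)" using SW by blast
    qed
  qed simp
  also have "\<dots> \<le> (\<Sum>SW\<in>Q. measure_pmf.prob (coins U p) (bad SW))"
    using finQ by (intro measure_pmf.finite_measure_subadditive_finite) auto
  also have "\<dots> \<le> (\<Sum>(S, W)\<in>Q. x ^ card S * x ^ (m - card W) + x ^ (m - card S) * x ^ card W)"
    using bad_le by (intro sum_mono) auto
  also have "\<dots> = (\<Sum>(S, W)\<in>Q. x ^ card S * x ^ (m - card W)) + (\<Sum>(S, W)\<in>Q. x ^ (m - card S) * x ^ card W)"
    by (simp add: sum.distrib case_prod_unfold)
  also have "\<dots> \<le> (\<Sum>(S, W)\<in>(Pow A - {{}}) \<times> Pow B. x ^ card S * x ^ (m - card W)) +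
      (\<Sum>(S, W)\<in>Pow A \<times> (Pow B - {{}}). x ^ (m - card S) * x ^ card W)"
  proof (intro add_mono sum_mono2)
    \<comment> \<open>Neither size exceeds \<open>m\<close>, yet they add up to more. Leaving out
      the empty set produces the \<open>- 1\<close> in the bound, without which it would not tend to
      0.\<close>
    have "S \<noteq> {}" "W \<noteq> {}" if "(S, W) \<in> Q" for S W
      using card_le[OF that] that by (auto simp: Q_def)
    then show "Q \<subseteq> (Pow A - {{}}) \<times> Pow B" "Q \<subseteq> Pow A \<times> (Pow B - {{}})" by (auto simp: Q_def)
  qed (use A B x in auto)
  also have "\<dots> = 2 * (((1 + x) ^ m - 1) * (1 + x) ^ m)"
    unfolding sum.cartesian_product[symmetric] sum_product[symmetric] sums by simp
  finally show ?thesis .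
qed

section \<open>Random graphs\<close>

lemma finite_all_pairs: "finite (all_pairs n)"
  by (rule finite_subset[of _ "Pow {..<n}"]) (auto simp: all_pairs_def)

lemma card_all_pairs: "card (all_pairs n) = n choose 2"
  by (simp add: all_pairs_def n_subsets)

lemma real_choose_two: "real (n choose 2) = real n * (real n - 1) / 2"
proof -
  have "even (n * (n - 1))" by (cases n) simp_all
  then show ?thesis by (cases n) (simp_all add: choose_two real_of_nat_div algebra_simps)
qed

definition residue_class :: "nat \<Rightarrow> nat \<Rightarrow> nat \<Rightarrow> nat set" where
  "residue_class \<tau> m x = {v. v < \<tau> * m \<and> v mod \<tau> = x}"

lemma residue_classes:
  assumes "\<tau> > 0"
  shows "disjoint_family_on (residue_class \<tau> m) {..<\<tau>}" "x < \<tau> \<Longrightarrow> finite (residue_class \<tau> m x) \<and> card (residue_class \<tau> m x) = m"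
    "{..<\<tau> * m} = (\<Union>x<\<tau>. residue_class \<tau> m x)"
proof -
  show "disjoint_family_on (residue_class \<tau> m) {..<\<tau>}" by (auto simp: disjoint_family_on_def residue_class_def)
  show "{..<\<tau> * m} = (\<Union>x<\<tau>. residue_class \<tau> m x)" using assms(1) by (auto simp: residue_class_def)
  assume x: "x < \<tau>"
  have "residue_class \<tau> m x = (\<lambda>i. \<tau> * i + x) ` {..<m}"
  proof (intro equalityI subsetI)
    fix v assume "v \<in> residue_class \<tau> m x"
    then have "v < \<tau> * m" "v = \<tau> * (v div \<tau>) + x" by (auto simp: residue_class_def)
    moreover have "v div \<tau> < m" using \<open>v < \<tau> * m\<close> by (simp add: less_mult_imp_div_less mult.commute)
    ultimately show "v \<in> (\<lambda>i. \<tau> * i + x) ` {..<m}" by blast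
  next
    fix v assume "v \<in> (\<lambda>i. \<tau> * i + x) ` {..<m}"
    then obtain i where i: "i < m" "v = \<tau> * i + x" by blast
    have "\<tau> * i + x < \<tau> * Suc i" using x by simp
    also have "\<dots> \<le> \<tau> * m" using i by (intro mult_le_mono2) simp
    finally show "v \<in> residue_class \<tau> m x" using i x by (simp add: residue_class_def)
  qed
  moreover have "inj_on (\<lambda>i. \<tau> * i + x) {..<m}" using assms(1) by (auto simp: inj_on_def)
  ultimately show "finite (residue_class \<tau> m x) \<and> card (residue_class \<tau> m x) = m" by (simp add: card_image)
qed

text \<open>\<open>(m - s) * (m - w) \<ge> 0\<close> says
  \<open>s * w \<ge> m * (s + w - m)\<close>, so density \<open>c\<close> yields Ore's condition for
  every \<open>k \<le> c * m\<close>. It holds trivially if \<open>s + w \<le> m\<close>, and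
  density is required only for the other pairs.\<close>

lemma ore_of_dense:
  fixes s w m k d :: nat and c :: real
  assumes "s \<le> m" "w \<le> m" "k \<le> c * m" "0 \<le> c" and d: "m < s + w \<Longrightarrow> c * real (s * w) \<le> d"
  shows "k * (s + w) \<le> d + k * m"
proof (cases "m < s + w")
  case True
  have "0 \<le> (real m - s) * (real m - w)" using assms by simp
  then have "real m * (real s + w - m) \<le> s * w" by (simp add: algebra_simps)
  then have "c * (real m * (real s + w - m)) \<le> c * (s * w)" using assms(4) by (rule mult_left_mono)
  moreover have "real k * (real s + w - m) \<le> c * m * (real s + w - m)"
    using assms(3) True by (intro mult_right_mono) auto
  ultimately have "real k * (real s + w - m) \<le> d" using d[OF True] by (simp add: mult.assoc)
  then have "real (k * (s + w)) \<le> real (d + k * m)" by (simp add: algebra_simps)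
  then show ?thesis by linarith
next
  case False
  then have "k * (s + w) \<le> k * m" by (intro mult_le_mono2) simp
  then show ?thesis by (rule trans_le_add2)
qed

text \<open>The statement for fixed \<open>m\<close>, with all limits removed. The bound on
  \<open>N\<close> makes rounding to a multiple of \<open>N\<close> cost at most
  \<open>\<delta> * p * m\<close>. The condition on \<open>\<epsilon>\<close> compares
  \<open>(1 + \<delta>) * p * n\<^sup>2 / 2\<close>, an upper bound for all edges, with
  \<open>(1 - 1 / \<tau>) * (1 - 2 * \<delta>) * p * n\<^sup>2 / 2\<close>, a lower bound for the
  covered ones.\<close>

lemma gnp_tree_packing_bound:
  fixes T :: "'a ugraph"
  assumes T: "is_tree T" "card (verts T) \<ge> 2" and \<tau>: "card (verts T) dvd \<tau>" "\<tau> > 0"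
  shows "\<exists>N::nat. \<forall>m p \<delta> \<epsilon> x. 0 < p \<longrightarrow> p \<le> 1 \<longrightarrow> 0 < \<delta> \<longrightarrow> \<delta> \<le> 1 \<longrightarrow> 0 \<le> x \<longrightarrow> x \<le> 1 \<longrightarrow>
    \<epsilon> \<le> 1 \<longrightarrow> exp (- (p * real m * \<delta>\<^sup>2 / 8)) \<le> x\<^sup>2 \<longrightarrow> real N \<le> \<delta> * (p * real m) \<longrightarrow>
    (1 - \<epsilon>) * (1 + \<delta>) \<le> (1 - 1 / real \<tau>) * (1 - 2 * \<delta>) \<longrightarrow>
    1 - (exp (- (p * real ((\<tau> * m) choose 2) * \<delta>\<^sup>2 / 4)) +
        (real \<tau>)\<^sup>2 * (2 * (((1 + x) ^ m - 1) * (1 + x) ^ m)))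
      \<le> measure_pmf.prob (gnp (\<tau> * m) p)
          {G. \<exists>\<F>. edge_disjoint_factors T G \<F> \<and>
               real (card (uncovered_edges G \<F>)) \<le> \<epsilon> * real (card (edges G))}"
proof -
  obtain N where "N > 0" and N: "\<And>(G :: nat ugraph) V m L. \<lbrakk>disjoint_family_on V {..<\<tau>};
      \<forall>x<\<tau>. finite (V x) \<and> card (V x) = m; verts G = (\<Union>x<\<tau>. V x);
      \<forall>x<\<tau>. \<forall>y<\<tau>. x \<noteq> y \<longrightarrow> (\<forall>S\<subseteq>V x. \<forall>W\<subseteq>V y.
        N * L * (card S + card W) \<le> card (edges G \<inter> cross S W) + N * L * m)\<rbrakk> \<Longrightarrow>
    \<exists>\<F>. edge_disjoint_factors T G \<F> \<and> (\<Union>F\<in>\<F>. factor_edges F) \<subseteq> edges G \<and>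
      card (\<Union>F\<in>\<F>. factor_edges F) = m * ((\<tau> choose 2) * (N * L))"
    using tree_packing_of_ore[OF T \<tau>, where 'v = nat] by metis
  show ?thesis
  proof (intro exI[of _ N] allI impI)
    fix m :: nat and p \<delta> \<epsilon> x :: real
    assume p: "0 < p" "p \<le> 1" and \<delta>: "0 < \<delta>" "\<delta> \<le> 1" and x: "0 \<le> x" "x \<le> 1" "exp (- (p * real m * \<delta>\<^sup>2 / 8)) \<le> x\<^sup>2"
      and "\<epsilon> \<le> 1" and N\<delta>: "real N \<le> \<delta> * (p * real m)"
      and \<epsilon>: "(1 - \<epsilon>) * (1 + \<delta>) \<le> (1 - 1 / real \<tau>) * (1 - 2 * \<delta>)"
    define n where "n = \<tau> * m"
    define U where "U = all_pairs n"
    define V where "V = residue_class \<tau> m"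
    note V = residue_classes[where m = m, OF \<tau>(2), folded V_def]
    define P where "P G \<longleftrightarrow> (\<exists>\<F>. edge_disjoint_factors T G \<F> \<and>
               real (card (uncovered_edges G \<F>)) \<le> \<epsilon> * real (card (edges G)))" for G :: "nat ugraph"
    define gr where "gr b = Ugraph {..<n} {e \<in> U. b e}" for b
    \<comment> \<open>The only use of the upper tail: the loss is measured against the actual number
      of edges, which must not be too large compared with the covered ones.\<close>
    define many where "many = {b. real (card {e\<in>U. b e}) > (1 + \<delta>) * p * real (card U)}"
    define sparse where "sparse = (\<lambda>(x, y). {b. \<exists>S\<subseteq>V x. \<exists>W\<subseteq>V y. m < card S + card W \<and>
      real (card {e\<in>cross S W. b e}) < (1 - \<delta>) * p * real (card S * card W)})"
    define I where "I = {(x, y). x < \<tau> \<and> y < \<tau> \<and> x \<noteq> y}"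
    have finI: "finite I" and cI: "card I \<le> \<tau>\<^sup>2"
    proof -
      have "I \<subseteq> {..<\<tau>} \<times> {..<\<tau>}" by (auto simp: I_def)
      then show "finite I" "card I \<le> \<tau>\<^sup>2"
        using finite_subset card_mono[of "{..<\<tau>} \<times> {..<\<tau>}" I]
        by (auto simp: card_cartesian_product power2_eq_square)
    qed
    have finU: "finite U" by (simp add: U_def finite_all_pairs)
    have Vdisj: "V x \<inter> V y = {}" if "x \<noteq> y" for x y using that by (auto simp: V_def residue_class_def)
    have crossU: "cross (V x) (V y) \<subseteq> U" if "x \<noteq> y" for x y
      using Vdisj[OF that] by (auto simp: cross_def U_def all_pairs_def V_def residue_class_def n_def card_2_iff)
    have good: "P (gr b)" if b: "b \<notin> many" "\<And>xy. xy \<in> I \<Longrightarrow> b \<notin> sparse xy" for b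
    proof -
      \<comment> \<open>The largest \<open>L\<close> for which \<open>N * L\<close> is at most the
        degree \<open>(1 - \<delta>) * p * m\<close> that the density supports.\<close>
      define L where "L = nat \<lfloor>(1 - \<delta>) * (p * m) / N\<rfloor>"
      have "0 \<le> (1 - \<delta>) * (p * m) / N" using \<delta> p by simp
      then have "real L \<le> (1 - \<delta>) * (p * m) / N" "(1 - \<delta>) * (p * m) / N < real L + 1"
        by (auto simp: L_def)
      then have L: "real (N * L) \<le> (1 - \<delta>) * p * m" "(1 - \<delta>) * (p * m) - N \<le> real (N * L)"
        using \<open>N > 0\<close> by (auto simp: field_simps)
      have "\<exists>\<F>. edge_disjoint_factors T (gr b) \<F> \<and> (\<Union>F\<in>\<F>. factor_edges F) \<subseteq> edges (gr b) \<and>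
        card (\<Union>F\<in>\<F>. factor_edges F) = m * ((\<tau> choose 2) * (N * L))"
      proof (rule N[OF V(1)])
        show "\<forall>x<\<tau>. finite (V x) \<and> card (V x) = m" by (intro allI impI V(2))
        show "verts (gr b) = (\<Union>x<\<tau>. V x)" using V(3) by (simp add: gr_def n_def)
        show "\<forall>x<\<tau>. \<forall>y<\<tau>. x \<noteq> y \<longrightarrow> (\<forall>S\<subseteq>V x. \<forall>W\<subseteq>V y.
          N * L * (card S + card W) \<le> card (edges (gr b) \<inter> cross S W) + N * L * m)"
        proof (intro allI impI)
          fix x y S W assume xy: "x < \<tau>" "y < \<tau>" "x \<noteq> y" and SW: "S \<subseteq> V x" "W \<subseteq> V y"
          have "cross S W \<subseteq> U" using crossU[OF xy(3)] SW by (fastforce simp: cross_def)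
          then have eq: "edges (gr b) \<inter> cross S W = {e\<in>cross S W. b e}" by (auto simp: gr_def)
          show "N * L * (card S + card W) \<le> card (edges (gr b) \<inter> cross S W) + N * L * m"
          proof (rule ore_of_dense[where c = "(1 - \<delta>) * p"])
            show "card S \<le> m" "card W \<le> m"
              using V(2)[OF xy(1)] V(2)[OF xy(2)] SW card_mono by metis+
            assume "m < card S + card W"
            show "(1 - \<delta>) * p * real (card S * card W) \<le> card (edges (gr b) \<inter> cross S W)"
            proof (rule ccontr)
              assume "\<not> ?thesis"
              then have "b \<in> sparse (x, y)"
                unfolding sparse_def prod.case mem_Collect_eq
                using SW \<open>m < card S + card W\<close> by (intro exI[of _ S] exI[of _ W] conjI) (auto simp: eq)
              then show False using b(2)[of "(x, y)"] xy by (simp add: I_def)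
            qed
          qed (use L \<delta> p in auto)
        qed
      qed
      then obtain \<F> where F: "edge_disjoint_factors T (gr b) \<F>"
        "(\<Union>F\<in>\<F>. factor_edges F) \<subseteq> edges (gr b)"
        "card (\<Union>F\<in>\<F>. factor_edges F) = m * ((\<tau> choose 2) * (N * L))" by blast
      have fin: "finite (edges (gr b))" using finU by (simp add: gr_def)
      have "card (uncovered_edges (gr b) \<F>) + m * ((\<tau> choose 2) * (N * L)) = card (edges (gr b))"
        unfolding uncovered_edges_def F(3)[symmetric]
        using card_Diff_subset[OF finite_subset[OF F(2) fin] F(2)] card_mono[OF fin F(2)] by simp
      then have "real (card (uncovered_edges (gr b) \<F>)) =
          real (card (edges (gr b))) - real (m * ((\<tau> choose 2) * (N * L)))" by linarith
      moreover have "(1 - \<epsilon>) * real (card (edges (gr b))) \<le> real (m * ((\<tau> choose 2) * (N * L)))"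
      proof -
        have "(1 - \<epsilon>) * real (card (edges (gr b))) \<le> (1 - \<epsilon>) * ((1 + \<delta>) * p * real (n choose 2))"
          using b(1) \<open>\<epsilon> \<le> 1\<close> by (intro mult_left_mono) (auto simp: many_def gr_def U_def card_all_pairs)
        also have "\<dots> \<le> (1 - \<epsilon>) * ((1 + \<delta>) * p * ((real n)\<^sup>2 / 2))"
          using \<open>\<epsilon> \<le> 1\<close> \<delta> p by (intro mult_left_mono) (auto simp: real_choose_two power2_eq_square algebra_simps)
        also have "\<dots> = ((1 - \<epsilon>) * (1 + \<delta>)) * (p * (real n)\<^sup>2 / 2)" by simp
        also have "\<dots> \<le> ((1 - 1 / real \<tau>) * (1 - 2 * \<delta>)) * (p * (real n)\<^sup>2 / 2)"
          using \<epsilon> p by (intro mult_right_mono) auto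
        \<comment> \<open>\<open>\<tau> choose 2\<close> is
          \<open>(1 - 1 / \<tau>) * \<tau>\<^sup>2 / 2\<close>. Of the \<open>2 * \<delta>\<close>,
          one \<open>\<delta>\<close> stems from the density and one from rounding.\<close>
        also have "\<dots> = real m * (real (\<tau> choose 2) * ((1 - \<delta>) * (p * m) - \<delta> * (p * m)))"
          using \<tau>(2) by (simp add: real_choose_two n_def field_simps power2_eq_square)
        also have "\<dots> \<le> real m * (real (\<tau> choose 2) * real (N * L))"
          using L(2) N\<delta> by (intro mult_left_mono) auto
        finally show ?thesis by simp
      qed
      ultimately have "real (card (uncovered_edges (gr b) \<F>)) \<le> \<epsilon> * real (card (edges (gr b)))"
        by (simp add: algebra_simps)
      then show ?thesis using F(1) by (auto simp: P_def)
    qed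
    have "1 - measure_pmf.prob (coins U p) {b. P (gr b)} = measure_pmf.prob (coins U p) (UNIV - {b. P (gr b)})"
      using measure_pmf.prob_compl[of "{b. P (gr b)}" "coins U p"] by simp
    also have "\<dots> \<le> measure_pmf.prob (coins U p) (many \<union> (\<Union>xy\<in>I. sparse xy))"
      using good by (intro measure_pmf.finite_measure_mono) auto
    also have "\<dots> \<le> measure_pmf.prob (coins U p) many + measure_pmf.prob (coins U p) (\<Union>xy\<in>I. sparse xy)"
      by (intro measure_Un_le) auto
    also have "\<dots> \<le> exp (- (p * real (n choose 2) * \<delta>\<^sup>2 / 4)) +
        (real \<tau>)\<^sup>2 * (2 * (((1 + x) ^ m - 1) * (1 + x) ^ m))"
    proof (rule add_mono)
      show "measure_pmf.prob (coins U p) many \<le> exp (- (p * real (n choose 2) * \<delta>\<^sup>2 / 4))"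
        using coins_upper_tail[OF finU order_refl, of p \<delta>] p \<delta>
        by (simp add: many_def U_def card_all_pairs)
      have "measure_pmf.prob (coins U p) (\<Union>xy\<in>I. sparse xy) \<le> (\<Sum>xy\<in>I. measure_pmf.prob (coins U p) (sparse xy))"
        using finI by (intro measure_pmf.finite_measure_subadditive_finite) auto
      also have "\<dots> \<le> (\<Sum>xy\<in>I. 2 * (((1 + x) ^ m - 1) * (1 + x) ^ m))"
      proof (rule sum_mono)
        fix xy assume "xy \<in> I"
        then obtain u v where uv: "xy = (u, v)" "u < \<tau>" "v < \<tau>" "u \<noteq> v" by (auto simp: I_def)
        show "measure_pmf.prob (coins U p) (sparse xy) \<le> 2 * (((1 + x) ^ m - 1) * (1 + x) ^ m)"
          unfolding sparse_def uv(1) prod.case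
          using V(2)[OF uv(2)] V(2)[OF uv(3)] crossU[OF uv(4)] Vdisj[OF uv(4)] p \<delta> x
          by (intro coins_cross_lower_tail[OF finU]) auto
      qed
      also have "\<dots> = card I * (2 * (((1 + x) ^ m - 1) * (1 + x) ^ m))" by simp
      also have "\<dots> \<le> (real \<tau>)\<^sup>2 * (2 * (((1 + x) ^ m - 1) * (1 + x) ^ m))"
      proof (rule mult_right_mono)
        show "real (card I) \<le> (real \<tau>)\<^sup>2" using cI by (metis of_nat_le_iff of_nat_power)
        show "0 \<le> 2 * (((1 + x) ^ m - 1) * (1 + x) ^ m)" using x one_le_power[of "1 + x" m] by simp
      qed
      finally show "measure_pmf.prob (coins U p) (\<Union>xy\<in>I. sparse xy) \<le>
        (real \<tau>)\<^sup>2 * (2 * (((1 + x) ^ m - 1) * (1 + x) ^ m))" .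
    qed
    finally have "1 - (exp (- (p * real (n choose 2) * \<delta>\<^sup>2 / 4)) +
        (real \<tau>)\<^sup>2 * (2 * (((1 + x) ^ m - 1) * (1 + x) ^ m))) \<le> measure_pmf.prob (coins U p) {b. P (gr b)}"
      by simp
    also have "\<dots> = measure_pmf.prob (gnp n p) {G. P G}"
      by (simp add: gnp_def gr_def U_def vimage_def)
    finally show "1 - (exp (- (p * real ((\<tau> * m) choose 2) * \<delta>\<^sup>2 / 4)) +
        (real \<tau>)\<^sup>2 * (2 * (((1 + x) ^ m - 1) * (1 + x) ^ m)))
      \<le> measure_pmf.prob (gnp (\<tau> * m) p)
          {G. \<exists>\<F>. edge_disjoint_factors T G \<F> \<and>
               real (card (uncovered_edges G \<F>)) \<le> \<epsilon> * real (card (edges G))}"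
      by (simp add: n_def P_def)
  qed
qed

section \<open>Choice of the constants and passage to the limit\<close>

theorem theorem3:
  fixes T :: "'a ugraph"
  assumes "is_tree T" and "card (verts T) \<ge> 2"
  shows "\<exists>M::real. \<forall>\<epsilon>::real. \<epsilon> > 0 \<longrightarrow>
    (\<exists>\<tau>0::nat. \<forall>\<tau>::nat. \<tau> \<ge> \<tau>0 \<and> card (verts T) dvd \<tau> \<longrightarrow>
      (\<exists>C::real. \<forall>p::nat \<Rightarrow> real.
        (\<forall>n. 0 < p n \<and> p n \<le> 1) \<and>
        (\<forall>\<^sub>F n in multiples_at_top \<tau>. p n > C * ln (real n) / real n) \<longrightarrow>
        ((\<lambda>n. measure_pmf.prob (gnp n (p n))
            {G. \<exists>\<F>. edge_disjoint_factors T G \<F> \<and>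
                 real (card (uncovered_edges G \<F>)) \<le> M * \<epsilon> * real (card (edges G))})
          \<longlongrightarrow> 1) (multiples_at_top \<tau>)))"
\<comment> \<open>\<open>M = 1\<close> suffices, since \<open>\<delta>\<close> and
  \<open>\<tau>0\<close> are adjusted to \<open>\<epsilon>\<close> itself.\<close>
proof (intro exI[of _ "1::real"] allI impI)
  fix \<epsilon> :: real assume "\<epsilon> > 0"
  define \<epsilon>' where "\<epsilon>' = min \<epsilon> 1"
  \<comment> \<open>The budget of \<open>6 * \<delta>\<close>: \<open>3 * \<delta>\<close> for edges
    inside classes, \<open>2 * \<delta>\<close> for edges between classes, and
    \<open>\<delta>\<close> for the excess in the total number of edges.\<close>
  define \<delta> where "\<delta> = \<epsilon>' / 6"
  have \<epsilon>': "0 < \<epsilon>'" "\<epsilon>' \<le> 1" "\<epsilon>' \<le> \<epsilon>" and \<delta>: "0 < \<delta>" "\<delta> \<le> 1" "\<epsilon>' = 6 * \<delta>"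
    using \<open>\<epsilon> > 0\<close> by (auto simp: \<epsilon>'_def \<delta>_def)
  show "\<exists>\<tau>0::nat. \<forall>\<tau>::nat. \<tau> \<ge> \<tau>0 \<and> card (verts T) dvd \<tau> \<longrightarrow>
      (\<exists>C::real. \<forall>p::nat \<Rightarrow> real.
        (\<forall>n. 0 < p n \<and> p n \<le> 1) \<and>
        (\<forall>\<^sub>F n in multiples_at_top \<tau>. p n > C * ln (real n) / real n) \<longrightarrow>
        ((\<lambda>n. measure_pmf.prob (gnp n (p n))
            {G. \<exists>\<F>. edge_disjoint_factors T G \<F> \<and>
                 real (card (uncovered_edges G \<F>)) \<le> 1 * \<epsilon> * real (card (edges G))})
          \<longlongrightarrow> 1) (multiples_at_top \<tau>))"
  \<comment> \<open>\<open>\<tau> \<ge> 2 / \<epsilon>'\<close> makes the share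
    \<open>1 / \<tau>\<close> of edges inside classes at most \<open>3 * \<delta>\<close>.\<close>
  proof (intro exI[of _ "nat \<lceil>2 / \<epsilon>'\<rceil> + 1"] allI impI, elim conjE)
    fix \<tau> :: nat assume \<tau>0: "\<tau> \<ge> nat \<lceil>2 / \<epsilon>'\<rceil> + 1" and dvd: "card (verts T) dvd \<tau>"
    then have \<tau>: "\<tau> > 0" "2 / \<epsilon>' \<le> \<tau>" by linarith+
    have "1 / real \<tau> \<le> 3 * \<delta>" using \<tau> \<delta> by (simp add: field_simps)
    then have "(1 / real \<tau>) * (1 - 2 * \<delta>) \<le> 3 * \<delta>"
      using \<delta> mult_left_le[of "1 - 2 * \<delta>" "1 / real \<tau>"] by simp
    moreover have "0 \<le> \<delta> * (\<delta> * 6)" using \<delta> by simp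
    moreover have "(1 - \<epsilon>') * (1 + \<delta>) = 1 - 5 * \<delta> - \<delta> * (\<delta> * 6)"
      unfolding \<delta>(3) by (simp add: algebra_simps)
    moreover have "(1 - 1 / real \<tau>) * (1 - 2 * \<delta>) = (1 - 2 * \<delta>) - (1 / real \<tau>) * (1 - 2 * \<delta>)"
      by (simp add: left_diff_distrib)
    ultimately have eps: "(1 - \<epsilon>') * (1 + \<delta>) \<le> (1 - 1 / real \<tau>) * (1 - 2 * \<delta>)"
      by linarith
    obtain N :: nat where N: "\<forall>m p \<delta> \<epsilon> x. 0 < p \<longrightarrow> p \<le> 1 \<longrightarrow> 0 < \<delta> \<longrightarrow> \<delta> \<le> 1 \<longrightarrow> 0 \<le> x \<longrightarrow> x \<le> 1 \<longrightarrow>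
    \<epsilon> \<le> 1 \<longrightarrow> exp (- (p * real m * \<delta>\<^sup>2 / 8)) \<le> x\<^sup>2 \<longrightarrow> real N \<le> \<delta> * (p * real m) \<longrightarrow>
    (1 - \<epsilon>) * (1 + \<delta>) \<le> (1 - 1 / real \<tau>) * (1 - 2 * \<delta>) \<longrightarrow>
    1 - (exp (- (p * real ((\<tau> * m) choose 2) * \<delta>\<^sup>2 / 4)) +
        (real \<tau>)\<^sup>2 * (2 * (((1 + x) ^ m - 1) * (1 + x) ^ m)))
      \<le> measure_pmf.prob (gnp (\<tau> * m) p)
          {G. \<exists>\<F>. edge_disjoint_factors T G \<F> \<and>
               real (card (uncovered_edges G \<F>)) \<le> \<epsilon> * real (card (edges G))}"
      using gnp_tree_packing_bound[OF assms dvd \<tau>(1)] by (elim exE) (rule that)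
    \<comment> \<open>Chosen so that \<open>p * m * \<delta>\<^sup>2 / 8 \<ge> 4 * ln n\<close>;
      then \<open>x = 1 / m\<^sup>2\<close> is admissible in the finite bound.\<close>
    define C where "C = 32 * real \<tau> / \<delta>\<^sup>2"
    \<comment> \<open>A lower bound for the probability that no longer involves \<open>p\<close>:
      \<open>1 / n\<close> for the upper tail, the rest from
      \<open>(1 + x) ^ m \<le> exp (m * x) = exp (\<tau> / n)\<close>.\<close>
    define B where "B n = 1 - (1 / real n + (real \<tau>)\<^sup>2 * (2 * ((exp (\<tau> / real n) - 1) * exp (\<tau> / real n))))" for n :: nat
    show "\<exists>C::real. \<forall>p::nat \<Rightarrow> real.
        (\<forall>n. 0 < p n \<and> p n \<le> 1) \<and>
        (\<forall>\<^sub>F n in multiples_at_top \<tau>. p n > C * ln (real n) / real n) \<longrightarrow>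
        ((\<lambda>n. measure_pmf.prob (gnp n (p n))
            {G. \<exists>\<F>. edge_disjoint_factors T G \<F> \<and>
                 real (card (uncovered_edges G \<F>)) \<le> 1 * \<epsilon> * real (card (edges G))})
          \<longlongrightarrow> 1) (multiples_at_top \<tau>)"
    proof (intro exI[of _ C] allI impI, elim conjE)
      fix p :: "nat \<Rightarrow> real"
      assume p01: "\<forall>n. 0 < p n \<and> p n \<le> 1"
        and large: "\<forall>\<^sub>F n in multiples_at_top \<tau>. p n > C * ln (real n) / real n"
      have le_top: "multiples_at_top \<tau> \<le> at_top" by (simp add: multiples_at_top_def)
      have mult: "\<forall>\<^sub>F n in multiples_at_top \<tau>. \<tau> dvd n"
        by (simp add: multiples_at_top_def eventually_inf_principal)
      \<comment> \<open>The constant \<open>N\<close> is absorbed by letting \<open>n\<close> grow,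
        not by \<open>C\<close>: \<open>\<delta> * p * m\<close> is at least
        \<open>32 * ln n\<close>.\<close>
      have "filterlim (\<lambda>n. 32 * ln (real n)) at_top at_top" by real_asymp
      then have "\<forall>\<^sub>F n in at_top. N \<le> 32 * ln (real n)" by (simp add: filterlim_at_top)
      then have lnN: "\<forall>\<^sub>F n in multiples_at_top \<tau>. N \<le> 32 * ln (real n)"
        using le_top by (rule filter_leD[rotated])
      have ge2: "\<forall>\<^sub>F n in multiples_at_top \<tau>. n \<ge> 2"
        using filter_leD[OF le_top eventually_ge_at_top] .
      have ev: "\<forall>\<^sub>F n in multiples_at_top \<tau>. B n \<le> measure_pmf.prob (gnp n (p n))
            {G. \<exists>\<F>. edge_disjoint_factors T G \<F> \<and>
                 real (card (uncovered_edges G \<F>)) \<le> 1 * \<epsilon> * real (card (edges G))}"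
        using mult large lnN ge2
      proof eventually_elim
        case (elim n)
        then obtain m where m: "n = \<tau> * m" by blast
        have m0: "m > 0" using elim m by (cases m) auto
        have nm: "real n = real \<tau> * real m" using m by simp
        have ln0: "0 \<le> ln (real n)" using elim by simp
        have pn: "C * ln (real n) \<le> p n * real n" using elim by (simp add: field_simps)
        have pm: "32 / \<delta>\<^sup>2 * ln (real n) \<le> p n * m"
        proof -
          have "real \<tau> * (32 / \<delta>\<^sup>2 * ln (real n)) \<le> real \<tau> * (p n * m)"
            using pn unfolding C_def nm by (simp add: mult_ac)
          then show ?thesis by (rule mult_left_le_imp_le) (use \<tau>(1) in simp)
        qed
        \<comment> \<open>Any \<open>x\<close> with \<open>m * x\<close> tending to 0 would make
          \<open>(1 + x) ^ m - 1\<close> vanish; here \<open>m * x = 1 / m\<close>.\<close>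
        define x where "x = 1 / (real m)\<^sup>2"
        have x: "0 \<le> x" "x \<le> 1" using m0 by (auto simp: x_def)
        have lnm: "ln (real m) \<le> ln (real n)" using m m0 \<tau>(1) by simp
        have "exp (- (p n * real m * \<delta>\<^sup>2 / 8)) \<le> exp (- (4 * ln (real m)))"
        proof -
          have "32 * ln (real n) \<le> p n * m * \<delta>\<^sup>2" using pm \<delta>(1) by (simp add: field_simps)
          then show ?thesis using lnm by simp
        qed
        also have "\<dots> = 1 / exp (real 4 * ln (real m))" by (simp add: exp_minus field_simps)
        also have "\<dots> = x\<^sup>2"
          using m0 unfolding exp_of_nat_mult by (simp add: x_def power_divide flip: power_mult)
        finally have x2: "exp (- (p n * real m * \<delta>\<^sup>2 / 8)) \<le> x\<^sup>2" .
        have N': "real N \<le> \<delta> * (p n * real m)"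
        proof -
          have "32 * ln (real n) \<le> (1 / \<delta>) * (32 * ln (real n))"
            using \<delta> ln0 by (intro mult_right_le_one_le[THEN order_trans] mult_le_cancel_right1[THEN iffD2]) (auto simp: field_simps)
          also have "\<dots> = \<delta> * (32 / \<delta>\<^sup>2 * ln (real n))" using \<delta> by (simp add: power2_eq_square)
          also have "\<dots> \<le> \<delta> * (p n * real m)" using pm \<delta> by (intro mult_left_mono) auto
          finally show ?thesis using elim by linarith
        qed
        have "exp (- (p n * real (n choose 2) * \<delta>\<^sup>2 / 4)) \<le> exp (- ln (real n))"
        proof -
          have "ln (real n) \<le> 4 * real \<tau> * ln (real n)"
            using \<tau>(1) ln0 mult_right_mono[of 1 "4 * real \<tau>" "ln (real n)"] by simp
          also have "\<dots> = (C * ln (real n)) * (\<delta>\<^sup>2 / 8)" using \<delta> by (simp add: C_def)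
          also have "\<dots> \<le> (p n * real n) * (\<delta>\<^sup>2 / 8)" using pn by (intro mult_right_mono) auto
          also have "\<dots> \<le> (p n * real n) * (\<delta>\<^sup>2 / 8) * (real n - 1)"
            using mult_left_mono[of 1 "real n - 1" "(p n * real n) * (\<delta>\<^sup>2 / 8)"] p01[rule_format, of n] elim by simp
          also have "\<dots> = p n * real (n choose 2) * \<delta>\<^sup>2 / 4" by (simp add: real_choose_two)
          finally show ?thesis by simp
        qed
        also have "\<dots> = 1 / real n" using elim by (simp add: exp_minus field_simps)
        finally have 1: "exp (- (p n * real (n choose 2) * \<delta>\<^sup>2 / 4)) \<le> 1 / real n" .
        have "(1 + x) ^ m \<le> exp x ^ m" using x by (intro power_mono exp_ge_add_one_self) auto
        also have "\<dots> = exp (real m * x)" by (simp add: exp_of_nat_mult)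
        also have "real m * x = \<tau> / real n" using m0 \<tau>(1) by (simp add: x_def nm power2_eq_square)
        finally have ex: "(1 + x) ^ m \<le> exp (\<tau> / real n)" .
        have "((1 + x) ^ m - 1) * (1 + x) ^ m \<le> (exp (\<tau> / real n) - 1) * exp (\<tau> / real n)"
          using ex x by (intro mult_mono) auto
        then have 2: "(real \<tau>)\<^sup>2 * (2 * (((1 + x) ^ m - 1) * (1 + x) ^ m)) \<le>
            (real \<tau>)\<^sup>2 * (2 * ((exp (\<tau> / real n) - 1) * exp (\<tau> / real n)))"
          by (intro mult_left_mono) auto
        have "B n \<le> 1 - (exp (- (p n * real (n choose 2) * \<delta>\<^sup>2 / 4)) +
            (real \<tau>)\<^sup>2 * (2 * (((1 + x) ^ m - 1) * (1 + x) ^ m)))"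
          unfolding B_def using 1 2 by linarith
        also have "\<dots> \<le> measure_pmf.prob (gnp n (p n)) {G. \<exists>\<F>. edge_disjoint_factors T G \<F> \<and>
               real (card (uncovered_edges G \<F>)) \<le> \<epsilon>' * real (card (edges G))}"
          unfolding m using p01 \<delta> x x2 N' \<epsilon>' eps by (intro N[rule_format]) (auto simp: m)
        also have "\<dots> \<le> measure_pmf.prob (gnp n (p n)) {G. \<exists>\<F>. edge_disjoint_factors T G \<F> \<and>
               real (card (uncovered_edges G \<F>)) \<le> 1 * \<epsilon> * real (card (edges G))}"
        proof (rule measure_pmf.finite_measure_mono)
          have "\<epsilon>' * real k \<le> 1 * \<epsilon> * real k" for k :: nat using \<epsilon>' by (simp add: mult_right_mono)
          then show "{G. \<exists>\<F>. edge_disjoint_factors T G \<F> \<and>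
               real (card (uncovered_edges G \<F>)) \<le> \<epsilon>' * real (card (edges G))} \<subseteq>
            {G. \<exists>\<F>. edge_disjoint_factors T G \<F> \<and>
               real (card (uncovered_edges G \<F>)) \<le> 1 * \<epsilon> * real (card (edges G))}"
            by (blast intro: order_trans)
        qed simp
        finally show ?case .
      qed
      have "B \<longlonglongrightarrow> 1" unfolding B_def by real_asymp
      then have lim: "(B \<longlongrightarrow> 1) (multiples_at_top \<tau>)" using le_top by (rule tendsto_mono[rotated])
      show "((\<lambda>n. measure_pmf.prob (gnp n (p n))
            {G. \<exists>\<F>. edge_disjoint_factors T G \<F> \<and>
                 real (card (uncovered_edges G \<F>)) \<le> 1 * \<epsilon> * real (card (edges G))})
          \<longlongrightarrow> 1) (multiples_at_top \<tau>)"
        by (rule tendsto_sandwich[OF ev _ lim tendsto_const]) simp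
    qed
  qed
qed

end
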